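(* Let $\mathcal{M}$ be the complete metric space of isometry classes of compact metric spaces with the Gromov-Hausdorff distance $d_{GH}$, and let $\mathcal{M}_{\le 0}\subset\mathcal{M}$ be the set of isometry classes of $0$-dimensional compact metric spaces, with the subspace topology. Then $\mathcal{M}_{\le 0}$ is a dense $G_\delta$ subset of $\mathcal{M}$, and hence $\mathcal{M}_{\le 0}$ is a Baire space. Furthermore, the complement in $\mathcal{M}_{\le 0}$ of the set of isometry classes of loosely embeddable $0$-dimensional compact metric spaces is of first Baire category in $\mathcal{M}_{\le 0}$.
   Context: Hausdorff distance: for subsets $X,Y$ of a metric space $(Z,d)$, $d_{H,Z}(X,Y)$ is the infimum of all $\varepsilon>0$ such that $X$ and $Y$ are each contained in the other's $\varepsilon$-neighborhood. Gromov-Hausdorff distance: $d_{GH}(X,Y)=\inf d_{H,Z}(X,Y)$, the infimum being over all metric spaces $Z$ containing $X$ and $Y$ as isometrically embedded subspaces. $(\mathcal{M},d_{GH})$ is the metric space of isometry classes of (nonempty) compact metric spaces; it is known to be complete and separable. Dimension means covering dimension: a finite open cover has order $n\ge 0$ if there are $n+1$ distinct members with nonempty common intersection but no $n+2$ such members; $\dim X=n$ if every finite open cover of $X$ has a finite open refinement of order $\le n$ and $n$ is the smallest integer with this property. For compact metric spaces, being $0$-dimensional is equivalent to being totally disconnected (having a basis of clopen sets). A subset of a topological space is $G_\delta$ if it is a countable intersection of open sets. A Baire space is a topological space in which countable intersections of dense open subsets are dense. A subset $Y$ of a topological space $T$ is of first (Baire) category (meager) if it is contained in a countable union of nowhere dense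 closed subsets of $T$. A loose embedding of a metric space $(X,d_X)$ into a metric space $(Y,d_Y)$ is a one-to-one continuous map $f:X\to Y$ such that for all $x,x',z,z'\in X$: $d_Y(f(x),f(x'))=d_Y(f(z),f(z'))$ if and only if $d_X(x,x')=d_X(z,z')$. A metric space is loosely embeddable if it has a loose embedding into some Euclidean space $\mathbb{R}^n$ with its usual distance. *)

theory Defs
  imports "HOL-Analysis.Analysis"
begin

section \<open>Isometries\<close>

definition isometric_embedding :: "'a metric \<Rightarrow> 'b metric \<Rightarrow> ('a \<Rightarrow> 'b) \<Rightarrow> bool" where
  "isometric_embedding X Y f \<longleftrightarrow>
     f \<in> mspace X \<rightarrow> mspace Y \<and>
     (\<forall>x\<in>mspace X. \<forall>x'\<in>mspace X. mdist Y (f x) (f x') = mdist X x x')"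

definition isometric :: "'a metric \<Rightarrow> 'b metric \<Rightarrow> bool" where
  "isometric X Y \<longleftrightarrow> (\<exists>f. isometric_embedding X Y f \<and> f ` mspace X = mspace Y)"

definition compact_metric :: "'a metric \<Rightarrow> bool" where
  "compact_metric X \<longleftrightarrow> mspace X \<noteq> {} \<and> compact_space (mtopology_of X)"

lemma isometric_embedding_inj:
  assumes "isometric_embedding X Y f" shows "inj_on f (mspace X)"
proof (rule inj_onI)
  fix x y assume xy: "x \<in> mspace X" "y \<in> mspace X" "f x = f y"
  have "f y \<in> mspace Y" using assms xy by (auto simp: isometric_embedding_def)
  then have "mdist Y (f x) (f y) = 0" using xy by simp
  then have "mdist X x y = 0" using assms xy(1,2) unfolding isometric_embedding_def by simp
  then show "x = y" using xy by simp
qed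

lemma isometric_refl: "isometric X X"
  unfolding isometric_def isometric_embedding_def by (intro exI[of _ id]) auto

lemma isometric_sym:
  assumes "isometric X Y" shows "isometric Y X"
proof -
  obtain f where f: "isometric_embedding X Y f" "f ` mspace X = mspace Y"
    using assms by (auto simp: isometric_def)
  define g where "g = inv_into (mspace X) f"
  have g: "g y \<in> mspace X" "f (g y) = y" if "y \<in> mspace Y" for y
    using that f(2) by (auto simp: g_def inv_into_into f_inv_into_f)
  have gf: "g (f x) = x" if "x \<in> mspace X" for x
    using that isometric_embedding_inj[OF f(1)] by (simp add: g_def)
  have "mdist X (g x) (g x') = mdist Y x x'" if "x \<in> mspace Y" "x' \<in> mspace Y" for x x'
  proof -
    have "mdist Y (f (g x)) (f (g x')) = mdist X (g x) (g x')"
      using f(1) g(1)[OF that(1)] g(1)[OF that(2)] unfolding isometric_embedding_def by blast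
    then show ?thesis using g(2) that by simp
  qed
  then have "isometric_embedding Y X g" using g by (auto simp: isometric_embedding_def)
  moreover have "g ` mspace Y = mspace X" using g gf f(2) by force
  ultimately show ?thesis by (auto simp: isometric_def)
qed

lemma isometric_trans:
  assumes "isometric X Y" "isometric Y Z" shows "isometric X Z"
proof -
  obtain f g where f: "isometric_embedding X Y f" "f ` mspace X = mspace Y"
    and g: "isometric_embedding Y Z g" "g ` mspace Y = mspace Z"
    using assms by (auto simp: isometric_def)
  have "isometric_embedding X Z (g \<circ> f)"
    using f g by (auto simp: isometric_embedding_def Pi_iff)
  moreover have "(g \<circ> f) ` mspace X = mspace Z" using f(2) g(2) by (metis image_comp)
  ultimately show ?thesis unfolding isometric_def by blast
qed

lemma metric_transport:
  fixes Z :: "'a metric" and j :: "'a \<Rightarrow> 'b"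
  assumes "inj_on j S" "S \<subseteq> mspace Z"
  shows "\<exists>Z'::'b metric. mspace Z' = j ` S \<and>
           (\<forall>x\<in>S. \<forall>y\<in>S. mdist Z' (j x) (j y) = mdist Z x y)"
proof -
  let ?d = "\<lambda>x y. mdist Z (inv_into S j x) (inv_into S j y)"
  have "Metric_space (j ` S) ?d"
  proof
    fix x y assume "x \<in> j ` S" "y \<in> j ` S"
    then show "(?d x y = 0) = (x = y)"
      by (metis assms(2) inv_into_injective inv_into_into mdist_zero subsetD)
  next
    fix x y z assume "x \<in> j ` S" "y \<in> j ` S" "z \<in> j ` S"
    then show "?d x z \<le> ?d x y + ?d y z"
      by (meson assms(2) inv_into_into mdist_triangle subsetD)
  qed (auto simp: mdist_commute)
  then interpret Metric_space "j ` S" ?d .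
  show ?thesis using assms(1) by (intro exI[of _ "metric (j ` S, ?d)"]) auto
qed

text \<open>Every compact metric space, over whatever type, is isometric to one whose carrier is a set
  of reals, since its cardinality is at most that of the continuum.  So nothing is lost by
  taking the points of the Gromov-Hausdorff space to be classes of elements of
  \<^typ>\<open>real metric\<close>.\<close>

lemma compact_metric_isometric_real:
  fixes X :: "'a metric"
  assumes "compact_metric X"
  shows "\<exists>Y::real metric. compact_metric Y \<and> isometric X Y"
proof -
  interpret Metric_space "mspace X" "mdist X" by simp
  have cX: "compact_space mtopology" and ne: "mspace X \<noteq> {}"
    using assms by (auto simp: compact_metric_def mtopology_of_def)
  have "mtotally_bounded (mspace X)"
    using cX compact_space_eq_mcomplete_mtotally_bounded by blast
  then have "\<forall>n. \<exists>K. finite K \<and> K \<subseteq> mspace X \<and>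
      mspace X \<subseteq> (\<Union>x\<in>K. mball x (inverse (real (Suc n))))"
    unfolding mtotally_bounded_def
    by (metis inverse_positive_iff_positive of_nat_0_less_iff zero_less_Suc)
  then obtain K where K: "\<And>n. finite (K n)" "\<And>n. K n \<subseteq> mspace X"
    "\<And>n. mspace X \<subseteq> (\<Union>x\<in>K n. mball x (inverse (real (Suc n))))" by metis
  define C where "C = (\<Union>n. K n)"
  have "countable C" using K(1) by (auto simp: C_def intro: countable_finite)
  then have injC: "inj_on (to_nat_on C) C" by (rule inj_on_to_nat_on)
  define h where "h x = {prod_encode (to_nat_on C c, n) |c n.
      c \<in> C \<and> mdist X c x < inverse (real (Suc n))}" for x
  have injh: "inj_on h (mspace X)"
  proof (rule inj_onI, rule ccontr)
    fix x y assume xy: "x \<in> mspace X" "y \<in> mspace X" "h x = h y" "x \<noteq> y"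
    then have "mdist X x y > 0" by simp
    then obtain n where n: "inverse (real (Suc n)) < mdist X x y / 2"
      using reals_Archimedean[of "mdist X x y / 2"] by auto
    obtain c where c: "c \<in> K n" "mdist X c x < inverse (real (Suc n))"
      using K(3)[of n] xy(1) by auto
    then have cC: "c \<in> C" by (auto simp: C_def)
    then have "prod_encode (to_nat_on C c, n) \<in> h x" using c by (auto simp: h_def)
    then have "prod_encode (to_nat_on C c, n) \<in> h y" using xy(3) by simp
    then obtain c' where "c' \<in> C" "to_nat_on C c = to_nat_on C c'"
      "mdist X c' y < inverse (real (Suc n))" by (auto simp: h_def)
    then have cy: "mdist X c y < inverse (real (Suc n))" using injC cC by (metis inj_onD)
    have "mdist X x y \<le> mdist X x c + mdist X c y"
      using K(2) c(1) xy by (intro mdist_triangle) auto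
    then show False using n c(2) cy mdist_commute[of X x c] by linarith
  qed
  obtain k :: "nat set \<Rightarrow> real" where "inj k"
    using nat_sets_eqpoll_reals by (auto simp: eqpoll_def bij_betw_def)
  then have "inj_on (k \<circ> h) (mspace X)" using injh by (meson comp_inj_on inj_on_subset subset_UNIV)
  from metric_transport[OF this subset_refl] obtain Y :: "real metric" where
    Y: "mspace Y = (k \<circ> h) ` mspace X"
       "\<forall>x\<in>mspace X. \<forall>y\<in>mspace X. mdist Y ((k \<circ> h) x) ((k \<circ> h) y) = mdist X x y"
    by blast
  have emb: "isometric_embedding X Y (k \<circ> h)"
    using Y by (auto simp: isometric_embedding_def)
  have "Lipschitz_continuous_map X Y (k \<circ> h)"
    unfolding Lipschitz_continuous_map_def using Y by (auto intro!: exI[of _ 1])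
  then have "continuous_map (mtopology_of X) (mtopology_of Y) (k \<circ> h)"
    by (rule Lipschitz_continuous_imp_continuous_map)
  then have "compactin (mtopology_of Y) ((k \<circ> h) ` mspace X)"
    using cX image_compactin by (metis compact_space_def mtopology_of_def topspace_mtopology)
  then have "compact_space (mtopology_of Y)" by (simp add: compact_space_def Y(1))
  then have "compact_metric Y" using ne Y(1) by (auto simp: compact_metric_def)
  moreover have "isometric X Y" using emb Y(1) by (auto simp: isometric_def)
  ultimately show ?thesis by blast
qed

section \<open>Hausdorff and Gromov-Hausdorff distance\<close>

definition metric_nbhd :: "'a metric \<Rightarrow> real \<Rightarrow> 'a set \<Rightarrow> 'a set" where
  "metric_nbhd Z e A = {z \<in> mspace Z. \<exists>a\<in>A. mdist Z z a < e}"

definition hausdorff_dist :: "'a metric \<Rightarrow> 'a set \<Rightarrow> 'a set \<Rightarrow> real" where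
  "hausdorff_dist Z A B =
     Inf {e. 0 < e \<and> A \<subseteq> metric_nbhd Z e B \<and> B \<subseteq> metric_nbhd Z e A}"

text \<open>Ambient spaces range over \<^typ>\<open>real metric\<close>; by lemma \<open>hausdorff_dist_ambient_real\<close> below,
  ambient spaces over other types contribute no further values.\<close>

definition gh_dist :: "real metric \<Rightarrow> real metric \<Rightarrow> real" where
  "gh_dist X Y = Inf {hausdorff_dist Z (f ` mspace X) (g ` mspace Y) |(Z :: real metric) f g.
     isometric_embedding X Z f \<and> isometric_embedding Y Z g}"

lemma hausdorff_dist_alt:
  assumes "A \<subseteq> mspace Z" "B \<subseteq> mspace Z"
  shows "hausdorff_dist Z A B = Inf {e. 0 < e \<and> (\<forall>a\<in>A. \<exists>b\<in>B. mdist Z a b < e) \<and>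
           (\<forall>b\<in>B. \<exists>a\<in>A. mdist Z b a < e)}"
  unfolding hausdorff_dist_def metric_nbhd_def
  by (rule arg_cong[of _ _ Inf]) (use assms in blast)

lemma hausdorff_dist_commute: "hausdorff_dist Z A B = hausdorff_dist Z B A"
  unfolding hausdorff_dist_def by (rule arg_cong[of _ _ Inf]) blast

lemma hausdorff_dist_ambient_real:
  fixes Z :: "'c metric" and X Y :: "real metric"
  assumes f: "isometric_embedding X Z f" and g: "isometric_embedding Y Z g"
  shows "\<exists>(Z'::real metric) f' g'. isometric_embedding X Z' f' \<and> isometric_embedding Y Z' g' \<and>
           hausdorff_dist Z' (f' ` mspace X) (g' ` mspace Y) =
           hausdorff_dist Z (f ` mspace X) (g ` mspace Y)"
proof -
  define S where "S = f ` mspace X \<union> g ` mspace Y"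
  have SZ: "S \<subseteq> mspace Z" using f g by (auto simp: S_def isometric_embedding_def)
  define p :: "real + real \<Rightarrow> 'c" where "p s = (case s of Inl x \<Rightarrow> f x | Inr y \<Rightarrow> g y)" for s
  define k :: "real + real \<Rightarrow> real" where "k s = (case s of Inl x \<Rightarrow> exp x | Inr y \<Rightarrow> - exp y)" for s
  have "exp x \<noteq> - exp y" for x y :: real
    using exp_gt_zero[of x] exp_gt_zero[of y] by linarith
  then have "inj k"
    by (auto simp: inj_def k_def split: sum.splits) metis
  moreover have "S \<subseteq> range p"
  proof
    fix s assume "s \<in> S"
    then consider x where "s = f x" | y where "s = g y" by (auto simp: S_def)
    then show "s \<in> range p"
      by cases (auto simp: p_def image_iff intro: exI[of _ "Inl _"] exI[of _ "Inr _"])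
  qed
  then have "inj_on (inv p) S" by (rule inj_on_inv_into)
  ultimately have "inj_on (k \<circ> inv p) S" by (meson comp_inj_on inj_on_subset subset_UNIV)
  from metric_transport[OF this SZ] obtain Z' :: "real metric" and j where Z':
    "mspace Z' = j ` S" "\<And>x y. x \<in> S \<Longrightarrow> y \<in> S \<Longrightarrow> mdist Z' (j x) (j y) = mdist Z x y" by blast
  have fS: "f x \<in> S" if "x \<in> mspace X" for x using that by (auto simp: S_def)
  have gS: "g x \<in> S" if "x \<in> mspace Y" for x using that by (auto simp: S_def)
  have 1: "isometric_embedding X Z' (j \<circ> f)" "isometric_embedding Y Z' (j \<circ> g)"
    using f g Z' fS gS by (auto simp: isometric_embedding_def)
  have "hausdorff_dist Z' ((j \<circ> f) ` mspace X) ((j \<circ> g) ` mspace Y) =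
        hausdorff_dist Z (f ` mspace X) (g ` mspace Y)"
  proof (subst (1 2) hausdorff_dist_alt)
    show "f ` mspace X \<subseteq> mspace Z" "g ` mspace Y \<subseteq> mspace Z"
      "(j \<circ> f) ` mspace X \<subseteq> mspace Z'" "(j \<circ> g) ` mspace Y \<subseteq> mspace Z'"
      using f g 1 by (auto simp: isometric_embedding_def)
  qed (simp add: Z' fS gS)
  with 1 show ?thesis by blast
qed

subsection \<open>Couplings\<close>

text \<open>A coupling gives the cross distances of a (pseudo)metric on the disjoint union.\<close>

definition coupling :: "'a metric \<Rightarrow> 'b metric \<Rightarrow> ('a \<Rightarrow> 'b \<Rightarrow> real) \<Rightarrow> bool" where
  "coupling X Y c \<longleftrightarrow>
    (\<forall>x\<in>mspace X. \<forall>y\<in>mspace Y. 0 \<le> c x y) \<and>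
    (\<forall>x\<in>mspace X. \<forall>x'\<in>mspace X. \<forall>y\<in>mspace Y.
        c x y \<le> mdist X x x' + c x' y \<and> mdist X x x' \<le> c x y + c x' y) \<and>
    (\<forall>y\<in>mspace Y. \<forall>y'\<in>mspace Y. \<forall>x\<in>mspace X.
        c x y \<le> mdist Y y y' + c x y' \<and> mdist Y y y' \<le> c x y + c x y')"

lemma couplingD:
  assumes "coupling X Y c" "x \<in> mspace X" "y \<in> mspace Y"
  shows "0 \<le> c x y"
    "x' \<in> mspace X \<Longrightarrow> c x y \<le> mdist X x x' + c x' y"
    "x' \<in> mspace X \<Longrightarrow> mdist X x x' \<le> c x y + c x' y"
    "y' \<in> mspace Y \<Longrightarrow> c x y \<le> mdist Y y y' + c x y'"
    "y' \<in> mspace Y \<Longrightarrow> mdist Y y y' \<le> c x y + c x y'"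
  using assms unfolding coupling_def by blast+

lemma coupling_metric:
  fixes X :: "'a metric" and Y :: "'b metric"
  assumes c: "coupling X Y c" and pos: "\<And>x y. x \<in> mspace X \<Longrightarrow> y \<in> mspace Y \<Longrightarrow> 0 < c x y"
  shows "\<exists>Z::('a + 'b) metric. mspace Z = mspace X <+> mspace Y \<and>
           isometric_embedding X Z Inl \<and> isometric_embedding Y Z Inr \<and>
           (\<forall>x\<in>mspace X. \<forall>y\<in>mspace Y. mdist Z (Inl x) (Inr y) = c x y)"
proof -
  define D where "D s t = (case (s, t) of
      (Inl x, Inl x') \<Rightarrow> mdist X x x' | (Inr y, Inr y') \<Rightarrow> mdist Y y y'
    | (Inl x, Inr y) \<Rightarrow> \<bar>c x y\<bar> | (Inr y, Inl x) \<Rightarrow> \<bar>c x y\<bar>)" for s t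
  have D: "D (Inl x) (Inl x') = mdist X x x'" "D (Inr y) (Inr y') = mdist Y y y'"
    "D (Inl x) (Inr y) = \<bar>c x y\<bar>" "D (Inr y) (Inl x) = \<bar>c x y\<bar>" for x x' y y'
    by (auto simp: D_def)
  have absc: "\<bar>c x y\<bar> = c x y" if "x \<in> mspace X" "y \<in> mspace Y" for x y
    using couplingD(1)[OF c that] by simp
  have tri: "c x y \<le> c x y' + mdist Y y' y" "c x y \<le> c x' y + mdist X x' x"
    if "x \<in> mspace X" "x' \<in> mspace X" "y \<in> mspace Y" "y' \<in> mspace Y" for x x' y y'
    using couplingD(2)[OF c that(1,3,2)] couplingD(4)[OF c that(1,3,4)]
      mdist_commute[of Y y' y] mdist_commute[of X x' x] by linarith+
  interpret Metric_space "mspace X <+> mspace Y" D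
  proof
    fix s t show "0 \<le> D s t" by (cases s; cases t) (auto simp: D)
    show "D s t = D t s" by (cases s; cases t) (auto simp: D mdist_commute)
  next
    fix s t assume "s \<in> mspace X <+> mspace Y" "t \<in> mspace X <+> mspace Y"
    then show "(D s t = 0) = (s = t)" using pos by (fastforce simp: D)
  next
    fix s t u assume "s \<in> mspace X <+> mspace Y" "t \<in> mspace X <+> mspace Y" "u \<in> mspace X <+> mspace Y"
    then show "D s u \<le> D s t + D t u"
      by (elim PlusE; hypsubst) (auto simp: D absc intro: mdist_triangle tri couplingD[OF c])
  qed
  show ?thesis
    by (rule exI[of _ "metric (mspace X <+> mspace Y, D)"])
       (use couplingD(1)[OF c] in \<open>auto simp: isometric_embedding_def D\<close>)
qed

lemma hausdorff_dist_le:
  assumes "A \<subseteq> mspace Z" "B \<subseteq> mspace Z" "0 < r"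
    "\<And>a. a \<in> A \<Longrightarrow> \<exists>b\<in>B. mdist Z a b < r" "\<And>b. b \<in> B \<Longrightarrow> \<exists>a\<in>A. mdist Z a b < r"
  shows "hausdorff_dist Z A B \<le> r"
  unfolding hausdorff_dist_alt[OF assms(1,2)]
proof (rule cInf_lower)
  show "bdd_below {e. 0 < e \<and> (\<forall>a\<in>A. \<exists>b\<in>B. mdist Z a b < e) \<and> (\<forall>b\<in>B. \<exists>a\<in>A. mdist Z b a < e)}"
    by (rule bdd_belowI[of _ 0]) auto
qed (use assms in \<open>auto simp: mdist_commute\<close>)

lemma compact_metric_bounded:
  assumes "compact_metric X"
  shows "\<exists>K>0. \<forall>x\<in>mspace X. \<forall>y\<in>mspace X. mdist X x y \<le> K"
proof -
  interpret Metric_space "mspace X" "mdist X" by simp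
  have "compactin mtopology (mspace X)"
    using assms by (auto simp: compact_metric_def mtopology_of_def compact_space_def)
  then have "mbounded (mspace X)" by (rule compactin_imp_mbounded)
  then show ?thesis using mbounded_alt_pos by auto
qed

lemma hausdorff_dist_embed:
  assumes X: "compact_metric X" and Y: "compact_metric Y"
    and f: "isometric_embedding X Z f" and g: "isometric_embedding Y Z g"
  shows "0 \<le> hausdorff_dist Z (f ` mspace X) (g ` mspace Y)"
    "hausdorff_dist Z (f ` mspace X) (g ` mspace Y) < r \<Longrightarrow>
      (\<forall>x\<in>mspace X. \<exists>y\<in>mspace Y. mdist Z (f x) (g y) < r) \<and>
      (\<forall>y\<in>mspace Y. \<exists>x\<in>mspace X. mdist Z (f x) (g y) < r)"
proof -
  let ?S = "{e. 0 < e \<and> (\<forall>a\<in>f ` mspace X. \<exists>b\<in>g ` mspace Y. mdist Z a b < e) \<and>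
      (\<forall>b\<in>g ` mspace Y. \<exists>a\<in>f ` mspace X. mdist Z b a < e)}"
  have fX: "f ` mspace X \<subseteq> mspace Z" and gY: "g ` mspace Y \<subseteq> mspace Z"
    using f g by (auto simp: isometric_embedding_def)
  note eq = hausdorff_dist_alt[OF fX gY]
  obtain K where K: "K > 0" "\<And>x y. x\<in>mspace X \<Longrightarrow> y\<in>mspace X \<Longrightarrow> mdist X x y \<le> K"
    using compact_metric_bounded[OF X] by blast
  obtain L where L: "L > 0" "\<And>x y. x\<in>mspace Y \<Longrightarrow> y\<in>mspace Y \<Longrightarrow> mdist Y x y \<le> L"
    using compact_metric_bounded[OF Y] by blast
  obtain x0 y0 where 0: "x0 \<in> mspace X" "y0 \<in> mspace Y"
    using X Y by (auto simp: compact_metric_def)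
  let ?B = "mdist Z (f x0) (g y0)"
  have 1: "mdist Z (f x) (g y0) < K + L + ?B + 1" if "x \<in> mspace X" for x
  proof -
    have "mdist Z (f x) (g y0) \<le> mdist Z (f x) (f x0) + ?B"
      using fX gY 0 that by (intro mdist_triangle) auto
    moreover have "mdist Z (f x) (f x0) = mdist X x x0"
      using f that 0 by (auto simp: isometric_embedding_def)
    ultimately show ?thesis using K(2)[OF that 0(1)] L(1) by linarith
  qed
  have 2: "mdist Z (g y) (f x0) < K + L + ?B + 1" if "y \<in> mspace Y" for y
  proof -
    have "mdist Z (g y) (f x0) \<le> mdist Z (g y) (g y0) + mdist Z (g y0) (f x0)"
      using fX gY 0 that by (intro mdist_triangle) auto
    moreover have "mdist Z (g y) (g y0) = mdist Y y y0"
      using g that 0 by (auto simp: isometric_embedding_def)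
    ultimately show ?thesis using L(2)[OF that 0(2)] K(1) mdist_commute[of Z "g y0" "f x0"] by linarith
  qed
  have "K + L + ?B + 1 \<in> ?S"
    using 1 2 0 K(1) L(1) by (auto intro!: add_pos_nonneg)
  then have ne: "?S \<noteq> {}" by blast
  show "0 \<le> hausdorff_dist Z (f ` mspace X) (g ` mspace Y)"
    unfolding eq by (rule cInf_greatest[OF ne]) auto
  assume "hausdorff_dist Z (f ` mspace X) (g ` mspace Y) < r"
  then obtain e where "e \<in> ?S" "e < r" unfolding eq using cInf_lessD[OF ne] by blast
  then have "\<forall>x\<in>mspace X. \<exists>y\<in>mspace Y. mdist Z (f x) (g y) < e"
      "\<forall>y\<in>mspace Y. \<exists>x\<in>mspace X. mdist Z (f x) (g y) < e"
    by (auto simp: mdist_commute[of Z "g _"])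
  then show "(\<forall>x\<in>mspace X. \<exists>y\<in>mspace Y. mdist Z (f x) (g y) < r) \<and>
      (\<forall>y\<in>mspace Y. \<exists>x\<in>mspace X. mdist Z (f x) (g y) < r)"
    using \<open>e < r\<close> by (meson less_trans)
qed

subsection \<open>Gromov-Hausdorff distance in terms of couplings\<close>

lemma coupling_embeddings:
  fixes X Y :: "real metric"
  assumes c: "coupling X Y c" and pos: "\<And>x y. x \<in> mspace X \<Longrightarrow> y \<in> mspace Y \<Longrightarrow> 0 < c x y"
    and r: "0 < r" "\<And>x. x \<in> mspace X \<Longrightarrow> \<exists>y\<in>mspace Y. c x y < r"
      "\<And>y. y \<in> mspace Y \<Longrightarrow> \<exists>x\<in>mspace X. c x y < r"
  shows "\<exists>(Z::real metric) f g. isometric_embedding X Z f \<and> isometric_embedding Y Z g \<and>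
           hausdorff_dist Z (f ` mspace X) (g ` mspace Y) \<le> r"
proof -
  obtain Z :: "(real + real) metric" where Z:
    "isometric_embedding X Z Inl" "isometric_embedding Y Z Inr"
    "\<forall>x\<in>mspace X. \<forall>y\<in>mspace Y. mdist Z (Inl x) (Inr y) = c x y"
    using coupling_metric[OF c pos] by blast
  have "hausdorff_dist Z (Inl ` mspace X) (Inr ` mspace Y) \<le> r"
  proof (rule hausdorff_dist_le)
    show "Inl ` mspace X \<subseteq> mspace Z" "Inr ` mspace Y \<subseteq> mspace Z"
      using Z(1,2) by (auto simp: isometric_embedding_def)
  qed (use r Z(3) in auto)
  with hausdorff_dist_ambient_real[OF Z(1,2)] show ?thesis by metis
qed

context
  fixes X Y :: "real metric"
  assumes X: "compact_metric X" and Y: "compact_metric Y"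
begin

private definition "ghS = {hausdorff_dist Z (f ` mspace X) (g ` mspace Y) |(Z :: real metric) f g.
     isometric_embedding X Z f \<and> isometric_embedding Y Z g}"

private lemma gh_eq: "gh_dist X Y = Inf ghS"
  by (simp add: gh_dist_def ghS_def)

private lemma ghS_nonneg: "h \<in> ghS \<Longrightarrow> 0 \<le> h"
  using hausdorff_dist_embed(1)[OF X Y] by (auto simp: ghS_def)

private lemma ghS_nonempty: "ghS \<noteq> {}"
proof -
  obtain K where K: "K > 0" "\<And>x y. x\<in>mspace X \<Longrightarrow> y\<in>mspace X \<Longrightarrow> mdist X x y \<le> K"
    using compact_metric_bounded[OF X] by blast
  obtain L where L: "L > 0" "\<And>x y. x\<in>mspace Y \<Longrightarrow> y\<in>mspace Y \<Longrightarrow> mdist Y x y \<le> L"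
    using compact_metric_bounded[OF Y] by blast
  have K': "mdist X x y \<le> 2 * K + 2 * L" if "x\<in>mspace X" "y\<in>mspace X" for x y
    using K(2)[OF that] K(1) L(1) by linarith
  have L': "mdist Y x y \<le> 2 * K + 2 * L" if "x\<in>mspace Y" "y\<in>mspace Y" for x y
    using L(2)[OF that] K(1) L(1) by linarith
  have "coupling X Y (\<lambda>_ _. K + L)"
    using K L K' L' by (auto simp: coupling_def)
  then have "\<exists>(Z::real metric) f g. isometric_embedding X Z f \<and> isometric_embedding Y Z g \<and>
           hausdorff_dist Z (f ` mspace X) (g ` mspace Y) \<le> K + L + 1"
    by (rule coupling_embeddings)
       (use K(1) L(1) X Y in \<open>auto simp: compact_metric_def intro: add_pos_pos\<close>)
  then show ?thesis by (auto simp: ghS_def)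
qed

lemma gh_dist_nonneg: "0 \<le> gh_dist X Y"
  unfolding gh_eq by (rule cInf_greatest[OF ghS_nonempty ghS_nonneg])

lemma gh_dist_le:
  assumes "coupling X Y c" "\<And>x y. x \<in> mspace X \<Longrightarrow> y \<in> mspace Y \<Longrightarrow> 0 < c x y"
    "0 < r" "\<And>x. x \<in> mspace X \<Longrightarrow> \<exists>y\<in>mspace Y. c x y < r"
      "\<And>y. y \<in> mspace Y \<Longrightarrow> \<exists>x\<in>mspace X. c x y < r"
  shows "gh_dist X Y \<le> r"
proof -
  obtain h where "h \<in> ghS" "h \<le> r" using coupling_embeddings[OF assms] by (auto simp: ghS_def)
  moreover have "bdd_below ghS" using ghS_nonneg by (rule bdd_belowI)
  ultimately show ?thesis unfolding gh_eq using cInf_lower by fastforce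
qed

lemma gh_dist_lessD:
  assumes "gh_dist X Y < r"
  shows "\<exists>c. coupling X Y c \<and> (\<forall>x\<in>mspace X. \<exists>y\<in>mspace Y. c x y < r) \<and>
      (\<forall>y\<in>mspace Y. \<exists>x\<in>mspace X. c x y < r)"
proof -
  obtain h where "h \<in> ghS" "h < r" using assms cInf_lessD[OF ghS_nonempty] by (auto simp: gh_eq)
  then obtain Z :: "real metric" and f g where Z: "isometric_embedding X Z f"
    "isometric_embedding Y Z g" "hausdorff_dist Z (f ` mspace X) (g ` mspace Y) < r"
    by (auto simp: ghS_def)
  have f: "f x \<in> mspace Z" if "x \<in> mspace X" for x using Z(1) that by (auto simp: isometric_embedding_def)
  have g: "g x \<in> mspace Z" if "x \<in> mspace Y" for x using Z(2) that by (auto simp: isometric_embedding_def)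
  have "coupling X Y (\<lambda>x y. mdist Z (f x) (g y))"
    unfolding coupling_def
  proof (intro conjI ballI)
    fix x x' y assume *: "x \<in> mspace X" "x' \<in> mspace X" "y \<in> mspace Y"
    have e: "mdist X x x' = mdist Z (f x) (f x')" using Z(1) * by (auto simp: isometric_embedding_def)
    show "mdist Z (f x) (g y) \<le> mdist X x x' + mdist Z (f x') (g y)"
      unfolding e using f g * by (intro mdist_triangle) auto
    show "mdist X x x' \<le> mdist Z (f x) (g y) + mdist Z (f x') (g y)"
      unfolding e mdist_commute[of Z "f x'"] using f g * by (intro mdist_triangle) auto
  next
    fix y y' x assume *: "y \<in> mspace Y" "y' \<in> mspace Y" "x \<in> mspace X"
    have e: "mdist Y y y' = mdist Z (g y) (g y')" using Z(2) * by (auto simp: isometric_embedding_def)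
    show "mdist Z (f x) (g y) \<le> mdist Y y y' + mdist Z (f x) (g y')"
      unfolding e mdist_commute[of Z "f x"] using f g *
      by (intro mdist_triangle) auto
    show "mdist Y y y' \<le> mdist Z (f x) (g y) + mdist Z (f x) (g y')"
      unfolding e mdist_commute[of Z "f x" "g y"] using f g * by (intro mdist_triangle) auto
  qed auto
  with hausdorff_dist_embed(2)[OF X Y Z] show ?thesis by blast
qed

end

lemma gh_dist_commute: "gh_dist X Y = gh_dist Y X"
  unfolding gh_dist_def by (rule arg_cong[of _ _ Inf]) (use hausdorff_dist_commute in blast)

lemma gh_dist_triangle:
  assumes X: "compact_metric X" and Y: "compact_metric Y" and W: "compact_metric W"
  shows "gh_dist X W \<le> gh_dist X Y + gh_dist Y W"
proof (rule field_le_epsilon)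
  fix e' :: real assume "0 < e'"
  define e where "e = e' / 4"
  have e: "e > 0" using \<open>0 < e'\<close> by (simp add: e_def)
  define r s where "r = gh_dist X Y + e" and "s = gh_dist Y W + e"
  have rs: "r > 0" "s > 0"
    using gh_dist_nonneg[OF X Y] gh_dist_nonneg[OF Y W] e by (auto simp: r_def s_def)
  obtain a where a: "coupling X Y a" "\<forall>x\<in>mspace X. \<exists>y\<in>mspace Y. a x y < r"
      "\<forall>y\<in>mspace Y. \<exists>x\<in>mspace X. a x y < r"
    using gh_dist_lessD[OF X Y, of r] e by (auto simp: r_def)
  obtain b where b: "coupling Y W b" "\<forall>x\<in>mspace Y. \<exists>y\<in>mspace W. b x y < s"
      "\<forall>y\<in>mspace W. \<exists>x\<in>mspace Y. b x y < s"
    using gh_dist_lessD[OF Y W, of s] e by (auto simp: s_def)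
  define I where "I x w = (INF y\<in>mspace Y. a x y + b y w)" for x w
  have neY: "mspace Y \<noteq> {}" using Y by (simp add: compact_metric_def)
  have lo: "I x w \<le> a x y + b y w" if "x \<in> mspace X" "w \<in> mspace W" "y \<in> mspace Y" for x w y
    unfolding I_def
    by (rule cINF_lower[OF bdd_belowI[of _ 0]])
       (use that couplingD(1)[OF a(1)] couplingD(1)[OF b(1)] in auto)
  have ge: "t \<le> I x w" if "\<And>y. y \<in> mspace Y \<Longrightarrow> t \<le> a x y + b y w" for t x w
    unfolding I_def using neY that by (intro cINF_greatest) auto
  have nn: "0 \<le> I x w" if "x \<in> mspace X" "w \<in> mspace W" for x w
    using that couplingD(1)[OF a(1)] couplingD(1)[OF b(1)] by (intro ge) auto
  have i1: "I x w \<le> mdist X x x' + I x' w"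
    if "x \<in> mspace X" "x' \<in> mspace X" "w \<in> mspace W" for x x' w
  proof -
    have "I x w - mdist X x x' \<le> I x' w"
      by (rule ge) (use lo[OF that(1,3)] couplingD(2)[OF a(1) that(1) _ that(2)] in fastforce)
    then show ?thesis by linarith
  qed
  have i3: "I x w \<le> mdist W w w' + I x w'"
    if "x \<in> mspace X" "w \<in> mspace W" "w' \<in> mspace W" for x w w'
  proof -
    have "I x w - mdist W w w' \<le> I x w'"
      by (rule ge) (use lo[OF that(1,2)] couplingD(4)[OF b(1) _ that(2,3)] in fastforce)
    then show ?thesis by linarith
  qed
  have i2: "mdist X x x' \<le> I x w + I x' w"
    if "x \<in> mspace X" "x' \<in> mspace X" "w \<in> mspace W" for x x' w
  proof -
    have "mdist X x x' - I x' w \<le> I x w"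
    proof (rule ge)
      fix y assume y: "y \<in> mspace Y"
      have "mdist X x x' - (a x y + b y w) \<le> I x' w"
      proof (rule ge)
        fix y' assume y': "y' \<in> mspace Y"
        show "mdist X x x' - (a x y + b y w) \<le> a x' y' + b y' w"
          using couplingD(3)[OF a(1) that(1) y that(2)] couplingD(4)[OF a(1) that(2) y y']
            couplingD(3)[OF b(1) y that(3) y'] by linarith
      qed
      then show "mdist X x x' - I x' w \<le> a x y + b y w" by linarith
    qed
    then show ?thesis by linarith
  qed
  have i4: "mdist W w w' \<le> I x w + I x w'"
    if "x \<in> mspace X" "w \<in> mspace W" "w' \<in> mspace W" for x w w'
  proof -
    have "mdist W w w' - I x w' \<le> I x w"
    proof (rule ge)
      fix y assume y: "y \<in> mspace Y"
      have "mdist W w w' - (a x y + b y w) \<le> I x w'"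
      proof (rule ge)
        fix y' assume y': "y' \<in> mspace Y"
        show "mdist W w w' - (a x y + b y w) \<le> a x y' + b y' w'"
          using couplingD(5)[OF b(1) y that(2,3)] couplingD(2)[OF b(1) y that(3) y']
            couplingD(5)[OF a(1) that(1) y y'] by linarith
      qed
      then show "mdist W w w' - I x w' \<le> a x y + b y w" by linarith
    qed
    then show ?thesis by linarith
  qed
  define c where "c x w = I x w + e" for x w
  have "coupling X W c"
    unfolding coupling_def c_def
  proof (intro conjI ballI)
    fix x x' w assume *: "x \<in> mspace X" "x' \<in> mspace X" "w \<in> mspace W"
    show "I x w + e \<le> mdist X x x' + (I x' w + e)" using i1[OF *] by linarith
    show "mdist X x x' \<le> I x w + e + (I x' w + e)" using i2[OF *] e by linarith
  next
    fix w w' x assume *: "w \<in> mspace W" "w' \<in> mspace W" "x \<in> mspace X"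
    show "I x w + e \<le> mdist W w w' + (I x w' + e)" using i3[OF *(3,1,2)] by linarith
    show "mdist W w w' \<le> I x w + e + (I x w' + e)" using i4[OF *(3,1,2)] e by linarith
  qed (use nn e in force)
  then have "gh_dist X W \<le> r + s + e"
  proof (rule gh_dist_le[OF X W])
    fix x assume x: "x \<in> mspace X"
    obtain y w where "y \<in> mspace Y" "w \<in> mspace W" "a x y < r" "b y w < s"
      using a(2) b(2) x by metis
    then show "\<exists>w\<in>mspace W. c x w < r + s + e" using lo[OF x] by (force simp: c_def)
  next
    fix w assume w: "w \<in> mspace W"
    obtain y x where "y \<in> mspace Y" "x \<in> mspace X" "a x y < r" "b y w < s"
      using a(3) b(3) w by metis
    then show "\<exists>x\<in>mspace X. c x w < r + s + e" using lo[OF _ w] by (force simp: c_def)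
  qed (use nn e rs in \<open>force simp: c_def\<close>)+
  then show "gh_dist X W \<le> gh_dist X Y + gh_dist Y W + e'"
    using e by (simp add: r_def s_def e_def)
qed

lemma gh_dist_isometric:
  assumes X: "compact_metric X" and Y: "compact_metric Y" and iso: "isometric X Y"
  shows "gh_dist X Y = 0"
proof (rule antisym)
  obtain f where f: "isometric_embedding X Y f" "f ` mspace X = mspace Y"
    using iso by (auto simp: isometric_def)
  have fY: "f x \<in> mspace Y" if "x \<in> mspace X" for x using f that by auto
  have f0: "mdist Y (f x) (f x) = 0" if "x \<in> mspace X" for x using fY[OF that] by simp
  have fd: "mdist X x x' = mdist Y (f x) (f x')" if "x \<in> mspace X" "x' \<in> mspace X" for x x'
    using f that by (auto simp: isometric_embedding_def)
  show "gh_dist X Y \<le> 0"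
  proof (rule field_le_epsilon)
    fix e :: real assume e: "0 < e"
    have "coupling X Y (\<lambda>x y. mdist Y (f x) y + e / 2)"
      unfolding coupling_def
    proof (intro conjI ballI)
      fix x x' y assume *: "x \<in> mspace X" "x' \<in> mspace X" "y \<in> mspace Y"
      have "mdist Y (f x) y \<le> mdist Y (f x) (f x') + mdist Y (f x') y"
        using * fY by (intro mdist_triangle) auto
      then show "mdist Y (f x) y + e / 2 \<le> mdist X x x' + (mdist Y (f x') y + e / 2)"
        using fd[OF *(1,2)] by linarith
      have "mdist Y (f x) (f x') \<le> mdist Y (f x) y + mdist Y y (f x')"
        using * fY by (intro mdist_triangle) auto
      then show "mdist X x x' \<le> mdist Y (f x) y + e / 2 + (mdist Y (f x') y + e / 2)"
        using fd[OF *(1,2)] e mdist_commute[of Y y "f x'"] by linarith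
    next
      fix y y' x assume *: "y \<in> mspace Y" "y' \<in> mspace Y" "x \<in> mspace X"
      have "mdist Y (f x) y \<le> mdist Y (f x) y' + mdist Y y' y"
        using * fY by (intro mdist_triangle) auto
      then show "mdist Y (f x) y + e / 2 \<le> mdist Y y y' + (mdist Y (f x) y' + e / 2)"
        using mdist_commute[of Y y y'] by linarith
      have "mdist Y y y' \<le> mdist Y y (f x) + mdist Y (f x) y'"
        using * fY by (intro mdist_triangle) auto
      then show "mdist Y y y' \<le> mdist Y (f x) y + e / 2 + (mdist Y (f x) y' + e / 2)"
        using e mdist_commute[of Y y "f x"] by linarith
    qed (use e in auto)
    then have "gh_dist X Y \<le> e"
    proof (rule gh_dist_le[OF X Y])
      fix x assume x: "x \<in> mspace X"
      have "mdist Y (f x) (f x) + e / 2 < e" using f0[OF x] e by linarith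
      then show "\<exists>y\<in>mspace Y. mdist Y (f x) y + e / 2 < e" using fY[OF x] by blast
    next
      fix y assume "y \<in> mspace Y"
      then obtain x where x: "x \<in> mspace X" "y = f x" using f(2) by auto
      have "mdist Y (f x) y + e / 2 < e" using f0[OF x(1)] x(2) e by simp
      then show "\<exists>x\<in>mspace X. mdist Y (f x) y + e / 2 < e" using x(1) by blast
    qed (use e in \<open>auto intro: add_nonneg_pos\<close>)
    then show "gh_dist X Y \<le> 0 + e" by simp
  qed
qed (rule gh_dist_nonneg[OF X Y])

text \<open>For vanishing distance, approximate isometries have a cluster point in the compact product
  space of all maps.\<close>

lemma gh_dist_zero_embedding:
  assumes X: "compact_metric X" and Y: "compact_metric Y" and 0: "gh_dist X Y = 0"
  shows "\<exists>f. isometric_embedding X Y f"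
proof -
  define P where "P = product_topology (\<lambda>_. mtopology_of Y) (mspace X)"
  have compP: "compact_space P"
    using Y by (simp add: P_def compact_space_product_topology compact_metric_def)
  define F where "F x x' n = {f \<in> topspace P. mdist Y (f x) (f x') \<in>
      {mdist X x x' - 2 * inverse (real (Suc n)) .. mdist X x x' + 2 * inverse (real (Suc n))}}"
    for x x' :: real and n :: nat
  define \<F> where "\<F> = {F x x' n |x x' n. x \<in> mspace X \<and> x' \<in> mspace X}"
  have closed: "closedin P C" if C: "C \<in> \<F>" for C
  proof -
    obtain x x' n where *: "C = F x x' n" "x \<in> mspace X" "x' \<in> mspace X" using C by (auto simp: \<F>_def)
    have "continuous_map P euclidean (\<lambda>f. mdist Y (f x) (f x'))"
      by (intro continuous_map_mdist)
         (use * in \<open>auto simp: P_def intro!: continuous_map_product_projection\<close>)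
    then show ?thesis unfolding *(1) F_def by (rule closedin_continuous_map_preimage) auto
  qed
  have fip: "\<Inter>\<G> \<noteq> {}" if \<G>: "finite \<G>" "\<G> \<subseteq> \<F>" for \<G>
  proof -
    have "\<forall>G\<in>\<G>. \<exists>n. \<exists>x\<in>mspace X. \<exists>x'\<in>mspace X. G = F x x' n"
      using \<G>(2) unfolding \<F>_def by blast
    then obtain N where N: "\<And>G. G \<in> \<G> \<Longrightarrow> \<exists>x\<in>mspace X. \<exists>x'\<in>mspace X. G = F x x' (N G)"
      by metis
    define M where "M = Max (insert 0 (N ` \<G>))"
    have M: "N G \<le> M" if "G \<in> \<G>" for G unfolding M_def using that \<G>(1) by (intro Max_ge) auto
    let ?r = "inverse (real (Suc M))"
    obtain c where c: "coupling X Y c" "\<forall>x\<in>mspace X. \<exists>y\<in>mspace Y. c x y < ?r"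
      using gh_dist_lessD[OF X Y, of ?r] 0 by auto
    then obtain f where f: "\<And>x. x \<in> mspace X \<Longrightarrow> f x \<in> mspace Y \<and> c x (f x) < ?r" by metis
    define g where "g = restrict f (mspace X)"
    have gP: "g \<in> topspace P" using f by (auto simp: g_def P_def)
    have "g \<in> G" if G: "G \<in> \<G>" for G
    proof -
      obtain x x' where x: "x \<in> mspace X" "x' \<in> mspace X" "G = F x x' (N G)" using N[OF G] by blast
      have le: "?r \<le> inverse (real (Suc (N G)))" using M[OF G] by (simp add: le_imp_inverse_le)
      have fx: "f x \<in> mspace Y" "f x' \<in> mspace Y" "c x (f x) < ?r" "c x' (f x') < ?r"
        using f x by auto
      have "mdist Y (f x) (f x') \<le> c x (f x) + c x (f x')"
        "c x (f x') \<le> mdist X x x' + c x' (f x')"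
        "mdist X x x' \<le> c x (f x) + c x' (f x)"
        "c x' (f x) \<le> mdist Y (f x) (f x') + c x' (f x')"
        using couplingD[OF c(1)] x fx by auto
      then have "mdist Y (f x) (f x') \<in> {mdist X x x' - 2 * ?r .. mdist X x x' + 2 * ?r}"
        using fx by auto
      then have "mdist Y (g x) (g x') \<in> {mdist X x x' - 2 * inverse (real (Suc (N G))) ..
            mdist X x x' + 2 * inverse (real (Suc (N G)))}"
        using x le unfolding atLeastAtMost_iff g_def restrict_def
        by (simp only: if_True) linarith
      then show ?thesis using gP by (subst x(3)) (simp only: F_def mem_Collect_eq simp_thms)
    qed
    then show ?thesis by blast
  qed
  obtain x0 where x0: "x0 \<in> mspace X" using X by (auto simp: compact_metric_def)
  have "\<Inter>\<F> \<noteq> {}"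
    using compP closed fip unfolding compact_space_fip by blast
  then obtain f where f: "\<And>x x' n. x \<in> mspace X \<Longrightarrow> x' \<in> mspace X \<Longrightarrow> f \<in> F x x' n"
    unfolding \<F>_def by blast
  have "f \<in> topspace P" using f[OF x0 x0, of 0] by (simp add: F_def)
  then have fY: "f \<in> mspace X \<rightarrow> mspace Y" by (auto simp: P_def)
  have "mdist Y (f x) (f x') = mdist X x x'" if x: "x \<in> mspace X" "x' \<in> mspace X" for x x'
  proof (rule ccontr)
    assume "mdist Y (f x) (f x') \<noteq> mdist X x x'"
    then have "\<bar>mdist Y (f x) (f x') - mdist X x x'\<bar> / 2 > 0" by simp
    then obtain n where "inverse (real (Suc n)) < \<bar>mdist Y (f x) (f x') - mdist X x x'\<bar> / 2"
      using reals_Archimedean by blast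
    then have n: "2 * inverse (real (Suc n)) < \<bar>mdist Y (f x) (f x') - mdist X x x'\<bar>" by simp
    have "mdist Y (f x) (f x') \<in> {mdist X x x' - 2 * inverse (real (Suc n)) ..
        mdist X x x' + 2 * inverse (real (Suc n))}"
      using f[OF x, of n] unfolding F_def by blast
    then have "mdist X x x' - 2 * inverse (real (Suc n)) \<le> mdist Y (f x) (f x')"
      "mdist Y (f x) (f x') \<le> mdist X x x' + 2 * inverse (real (Suc n))" by auto
    then show False using n by linarith
  qed
  then have "isometric_embedding X Y f" using fY by (simp add: isometric_embedding_def)
  then show ?thesis by blast
qed

lemma isometric_self_embedding_surj:
  assumes X: "compact_metric X" and h: "isometric_embedding X X h"
  shows "h ` mspace X = mspace X"
proof (rule ccontr)
  assume "h ` mspace X \<noteq> mspace X"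
  interpret Metric_space "mspace X" "mdist X" by simp
  have hX: "h x \<in> mspace X" if "x \<in> mspace X" for x using h that by (auto simp: isometric_embedding_def)
  have cX: "compact_space mtopology" using X by (simp add: compact_metric_def mtopology_of_def)
  obtain x where x: "x \<in> mspace X" "x \<notin> h ` mspace X"
    using \<open>h ` mspace X \<noteq> mspace X\<close> hX by auto
  have "Lipschitz_continuous_map X X h"
    unfolding Lipschitz_continuous_map_def using h hX
    by (auto simp: isometric_embedding_def intro!: exI[of _ 1])
  then have "continuous_map mtopology mtopology h"
    using Lipschitz_continuous_imp_continuous_map by (metis mtopology_of_def)
  then have "compactin mtopology (h ` mspace X)"
    using cX image_compactin by (metis compact_space_def topspace_mtopology)
  then have "closedin mtopology (h ` mspace X)"
    by (simp add: compactin_imp_closedin Hausdorff_space_mtopology)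
  then obtain e where e: "e > 0" "disjnt (h ` mspace X) (mball x e)"
    using x unfolding closedin_metric by blast
  have far: "e \<le> mdist X x (h y)" if "y \<in> mspace X" for y
  proof (rule ccontr)
    assume "\<not> e \<le> mdist X x (h y)"
    then have "h y \<in> mball x e" using hX that x by auto
    then show False using e(2) that by (auto simp: disjnt_iff)
  qed
  define s where "s n = (h ^^ n) x" for n
  have sX: "s n \<in> mspace X" for n by (induction n) (auto simp: s_def x hX)
  have sep: "e \<le> mdist X (s m) (s (m + Suc k))" for m k
  proof (induction m)
    case 0 show ?case using far[OF sX[of k]] by (simp add: s_def)
  next
    case (Suc m)
    have "mdist X (h (s m)) (h (s (m + Suc k))) = mdist X (s m) (s (m + Suc k))"
      using h sX by (auto simp: isometric_embedding_def)
    moreover have "s (Suc m) = h (s m)" "s (Suc m + Suc k) = h (s (m + Suc k))"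
      by (simp_all add: s_def)
    ultimately show ?case using Suc.IH by simp
  qed
  have "range s \<subseteq> mspace X" using sX by auto
  then obtain l r where "l \<in> mspace X" "strict_mono (r::nat\<Rightarrow>nat)" "limitin mtopology (s \<circ> r) l sequentially"
    using cX unfolding compact_space_sequentially by blast
  moreover then have "MCauchy (s \<circ> r)"
    using sX by (intro convergent_imp_MCauchy) auto
  then obtain N where "\<And>n n'. N \<le> n \<Longrightarrow> N \<le> n' \<Longrightarrow> mdist X ((s \<circ> r) n) ((s \<circ> r) n') < e"
    using e(1) unfolding MCauchy_def by blast
  then have lt: "mdist X (s (r N)) (s (r (Suc N))) < e" by simp
  moreover obtain k where "r (Suc N) = r N + Suc k"
    using \<open>strict_mono r\<close> by (metis lessI less_iff_Suc_add strict_mono_less add_Suc_right)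
  ultimately show False using sep[of "r N" k] by simp
qed

lemma gh_dist_eq_0_iff:
  assumes X: "compact_metric X" and Y: "compact_metric Y"
  shows "gh_dist X Y = 0 \<longleftrightarrow> isometric X Y"
proof
  assume 0: "gh_dist X Y = 0"
  obtain f where f: "isometric_embedding X Y f" using gh_dist_zero_embedding[OF X Y 0] by blast
  obtain g where g: "isometric_embedding Y X g"
    using gh_dist_zero_embedding[OF Y X] 0 gh_dist_commute by metis
  have "isometric_embedding Y Y (f \<circ> g)"
    using f g by (auto simp: isometric_embedding_def Pi_iff)
  then have "(f \<circ> g) ` mspace Y = mspace Y" by (rule isometric_self_embedding_surj[OF Y])
  then have "f ` mspace X = mspace Y"
    using f g by (fastforce simp: isometric_embedding_def)
  then show "isometric X Y" using f by (auto simp: isometric_def)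
qed (rule gh_dist_isometric[OF X Y])

section \<open>The space of isometry classes of compact metric spaces\<close>

definition gh_equiv :: "real metric \<Rightarrow> real metric \<Rightarrow> bool" where
  "gh_equiv X Y \<longleftrightarrow> compact_metric X \<and> compact_metric Y \<and> isometric X Y"

lemma gh_equiv_part_equivp: "part_equivp gh_equiv"
proof (rule part_equivpI)
  let ?m = "submetric euclidean_metric {0::real}"
  have "compactin (mtopology_of ?m) (topspace (mtopology_of ?m))"
    by (rule finite_imp_compactin) auto
  then have "compact_metric ?m" unfolding compact_metric_def compact_space_def by simp
  then have "gh_equiv ?m ?m" unfolding gh_equiv_def using isometric_refl by blast
  then show "\<exists>x. gh_equiv x x" by blast
next
  show "symp gh_equiv" unfolding symp_def gh_equiv_def using isometric_sym by blast
  show "transp gh_equiv" unfolding transp_def gh_equiv_def using isometric_trans by blast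
qed

quotient_type gh_space = "real metric" / partial: gh_equiv
  by (rule gh_equiv_part_equivp)

abbreviation isometry_class :: "real metric \<Rightarrow> gh_space" where
  "isometry_class \<equiv> abs_gh_space"

lemma compact_metric_rep: "compact_metric (rep_gh_space p)"
  using Quotient_rep_reflp[OF Quotient_gh_space, of p] by (simp add: gh_equiv_def)

lemma isometric_rep_iff: "isometric (rep_gh_space p) (rep_gh_space q) \<longleftrightarrow> p = q"
  using Quotient_rel_rep[OF Quotient_gh_space, of p q] compact_metric_rep
  by (simp add: gh_equiv_def)

lemma isometric_rep_class:
  assumes "compact_metric X" shows "isometric (rep_gh_space (isometry_class X)) X"
  using Quotient_rep_abs[OF Quotient_gh_space, of X] assms isometric_refl[of X]
  by (simp add: gh_equiv_def)

instantiation gh_space :: metric_space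
begin

definition dist_gh_space :: "gh_space \<Rightarrow> gh_space \<Rightarrow> real" where
  "dist_gh_space p q = gh_dist (rep_gh_space p) (rep_gh_space q)"

definition uniformity_gh_space :: "(gh_space \<times> gh_space) filter" where
  "uniformity_gh_space = (INF e\<in>{0 <..}. principal {(x, y). dist x y < e})"

definition open_gh_space :: "gh_space set \<Rightarrow> bool" where
  "open_gh_space U \<longleftrightarrow> (\<forall>x\<in>U. eventually (\<lambda>(x', y). x' = x \<longrightarrow> y \<in> U) uniformity)"

instance
proof
  fix x y z :: gh_space
  show "(dist x y = 0) = (x = y)"
    by (simp add: dist_gh_space_def gh_dist_eq_0_iff compact_metric_rep isometric_rep_iff)
  show "dist x y \<le> dist x z + dist y z"
    unfolding dist_gh_space_def gh_dist_commute[of "rep_gh_space y"]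
    by (intro gh_dist_triangle compact_metric_rep)
qed (simp_all add: uniformity_gh_space_def open_gh_space_def)

end

lemma isometry_class_eq_iff:
  assumes "compact_metric X" "compact_metric Y"
  shows "isometry_class X = isometry_class Y \<longleftrightarrow> isometric X Y"
  using Quotient_rel[OF Quotient_gh_space, of X Y] assms isometric_refl[of X] isometric_refl[of Y]
  by (simp add: gh_equiv_def)

lemma isometry_class_surj: "\<exists>X. compact_metric X \<and> p = isometry_class X"
  using Quotient_abs_rep[OF Quotient_gh_space, of p] compact_metric_rep[of p]
  by (intro exI[of _ "rep_gh_space p"]) simp

lemma dist_isometry_class:
  assumes X: "compact_metric X" and Y: "compact_metric Y"
  shows "dist (isometry_class X) (isometry_class Y) = gh_dist X Y"
proof -
  let ?X = "rep_gh_space (isometry_class X)" and ?Y = "rep_gh_space (isometry_class Y)"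
  have X': "compact_metric ?X" and Y': "compact_metric ?Y" by (rule compact_metric_rep)+
  have 0: "gh_dist ?X X = 0" "gh_dist ?Y Y = 0"
    by (rule gh_dist_isometric[OF X' X isometric_rep_class[OF X]],
        rule gh_dist_isometric[OF Y' Y isometric_rep_class[OF Y]])
  have "gh_dist ?X ?Y \<le> gh_dist ?X X + (gh_dist X Y + gh_dist Y ?Y)"
    using gh_dist_triangle[OF X' X Y'] gh_dist_triangle[OF X Y Y'] by linarith
  moreover have "gh_dist X Y \<le> gh_dist X ?X + (gh_dist ?X ?Y + gh_dist ?Y Y)"
    using gh_dist_triangle[OF X X' Y] gh_dist_triangle[OF X' Y' Y] by linarith
  ultimately show ?thesis
    using 0 gh_dist_commute[of X ?X] gh_dist_commute[of Y ?Y] by (simp add: dist_gh_space_def)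
qed

section \<open>Covering dimension\<close>

definition finite_open_cover :: "'a topology \<Rightarrow> 'a set set \<Rightarrow> bool" where
  "finite_open_cover X \<U> \<longleftrightarrow> finite \<U> \<and> (\<forall>U\<in>\<U>. openin X U) \<and> \<Union>\<U> = topspace X"

definition has_cover_order :: "'a set set \<Rightarrow> nat \<Rightarrow> bool" where
  "has_cover_order \<U> n \<longleftrightarrow>
     (\<exists>\<V>\<subseteq>\<U>. card \<V> = n + 1 \<and> \<Inter>\<V> \<noteq> {}) \<and>
     \<not> (\<exists>\<V>\<subseteq>\<U>. card \<V> = n + 2 \<and> \<Inter>\<V> \<noteq> {})"

definition covering_dim_le :: "'a topology \<Rightarrow> nat \<Rightarrow> bool" where
  "covering_dim_le X n \<longleftrightarrow>
     (\<forall>\<U>. finite_open_cover X \<U> \<longrightarrow>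
        (\<exists>\<V>. finite_open_cover X \<V> \<and> (\<forall>V\<in>\<V>. \<exists>U\<in>\<U>. V \<subseteq> U) \<and>
             (\<exists>k\<le>n. has_cover_order \<V> k)))"

definition has_covering_dim :: "'a topology \<Rightarrow> nat \<Rightarrow> bool" where
  "has_covering_dim X n \<longleftrightarrow> covering_dim_le X n \<and> (\<forall>k<n. \<not> covering_dim_le X k)"

section \<open>Loose embeddings\<close>

definition loose_embedding :: "'a metric \<Rightarrow> 'b metric \<Rightarrow> ('a \<Rightarrow> 'b) \<Rightarrow> bool" where
  "loose_embedding X Y f \<longleftrightarrow>
     continuous_map (mtopology_of X) (mtopology_of Y) f \<and> inj_on f (mspace X) \<and>
     (\<forall>x\<in>mspace X. \<forall>x'\<in>mspace X. \<forall>z\<in>mspace X. \<forall>z'\<in>mspace X.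
        mdist Y (f x) (f x') = mdist Y (f z) (f z') \<longleftrightarrow> mdist X x x' = mdist X z z')"

text \<open>Euclidean $n$-space with its usual distance, on the carrier of
  \<^term>\<open>Euclidean_space n\<close>, so that $n$ can be quantified.\<close>

definition Euclidean_space_metric :: "nat \<Rightarrow> (nat \<Rightarrow> real) metric" where
  "Euclidean_space_metric n =
     metric (topspace (Euclidean_space n), \<lambda>x y. sqrt (\<Sum>i<n. (x i - y i)\<^sup>2))"

lemma Metric_space_Euclidean_space:
  "Metric_space (topspace (Euclidean_space n)) (\<lambda>x y. sqrt (\<Sum>i<n. (x i - y i)\<^sup>2))"
proof
  fix x y :: "nat \<Rightarrow> real"
  show "0 \<le> sqrt (\<Sum>i<n. (x i - y i)\<^sup>2)" by (simp add: sum_nonneg)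
  show "sqrt (\<Sum>i<n. (x i - y i)\<^sup>2) = sqrt (\<Sum>i<n. (y i - x i)\<^sup>2)"
    by (simp add: power2_commute)
next
  fix x y :: "nat \<Rightarrow> real"
  assume xy: "x \<in> topspace (Euclidean_space n)" "y \<in> topspace (Euclidean_space n)"
  have "sqrt (\<Sum>i<n. (x i - y i)\<^sup>2) = 0 \<longleftrightarrow> (\<forall>i<n. x i = y i)"
    by (auto simp: sum_nonneg_eq_0_iff)
  also have "\<dots> \<longleftrightarrow> x = y"
    using xy unfolding topspace_Euclidean_space mem_Collect_eq fun_eq_iff by (metis not_le)
  finally show "(sqrt (\<Sum>i<n. (x i - y i)\<^sup>2) = 0) = (x = y)" .
next
  fix x y z :: "nat \<Rightarrow> real"
  show "sqrt (\<Sum>i<n. (x i - z i)\<^sup>2) \<le> sqrt (\<Sum>i<n. (x i - y i)\<^sup>2) + sqrt (\<Sum>i<n. (y i - z i)\<^sup>2)"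
    using L2_set_triangle_ineq[of "\<lambda>i. x i - y i" "\<lambda>i. y i - z i" "{..<n}"]
    by (simp add: L2_set_def)
qed

lemma mspace_Euclidean_space_metric [simp]:
  "mspace (Euclidean_space_metric n) = topspace (Euclidean_space n)"
  using Metric_space.mspace_metric[OF Metric_space_Euclidean_space]
  by (simp add: Euclidean_space_metric_def)

lemma mdist_Euclidean_space_metric [simp]:
  "mdist (Euclidean_space_metric n) x y = sqrt (\<Sum>i<n. (x i - y i)\<^sup>2)"
  using Metric_space.mdist_metric[OF Metric_space_Euclidean_space]
  by (simp add: Euclidean_space_metric_def)

definition loosely_embeddable :: "'a metric \<Rightarrow> bool" where
  "loosely_embeddable X \<longleftrightarrow> (\<exists>n f. loose_embedding X (Euclidean_space_metric n) f)"

section \<open>Baire category\<close>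

definition Baire_space :: "'a topology \<Rightarrow> bool" where
  "Baire_space X \<longleftrightarrow>
     (\<forall>\<U>. countable \<U> \<and> (\<forall>U\<in>\<U>. openin X U \<and> X closure_of U = topspace X) \<longrightarrow>
          X closure_of (topspace X \<inter> \<Inter>\<U>) = topspace X)"

definition first_category_in :: "'a topology \<Rightarrow> 'a set \<Rightarrow> bool" where
  "first_category_in X S \<longleftrightarrow>
     (\<exists>\<F>. countable \<F> \<and> (\<forall>F\<in>\<F>. closedin X F \<and> X interior_of F = {}) \<and> S \<subseteq> \<Union>\<F>)"

section \<open>Zero-dimensional classes\<close>

definition zero_dim_classes :: "gh_space set" where
  "zero_dim_classes =
     isometry_class ` {X. compact_metric X \<and> has_covering_dim (mtopology_of X) 0}"

definition loose_zero_dim_classes :: "gh_space set" where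
  "loose_zero_dim_classes =
     isometry_class ` {X. compact_metric X \<and> has_covering_dim (mtopology_of X) 0 \<and>
                          loosely_embeddable X}"

end

theory Submission
  imports Defs
begin

text \<open>A compact metric space is zero-dimensional iff, for every \<open>e > 0\<close>, it splits into pieces of
  diameter less than \<open>e\<close> lying at positive distance from each other.  For fixed \<open>e\<close> this is an open
  condition in the Gromov-Hausdorff distance, which gives the $G_\delta$ property; finite spaces are
  dense, and completeness of the Gromov-Hausdorff space gives the Baire property.  Finite spaces in
  which different pairs of points have different distances are dense as well, and having this
  property at all scales \<open>\<ge> e\<close> is again an open condition, so that generically all distances are
  distinct.  A zero-dimensional space with distinct distances embeds loosely into the real line: any
  continuous injection onto a set with pairwise distinct differences will do.\<close>

section \<open>Gromov-Hausdorff distance and maps of small distortion\<close>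

text \<open>Neither zero-dimensionality nor distinctness of all distances is open, so each is cut
  into countably many conditions with a scale \<open>e\<close> and an existential slack
  \<open>\<delta>\<close>. A nearby space is compared with the given one by a map that need not be
  continuous but changes distances little. Such a map consumes part of the slack and leaves the
  rest, which is why the conditions are stated through distances and not through open sets. For
  distances the obstacle is that two different pairs of points may lie close together and then have
  nearly equal distances; in an infinite compact space this cannot be avoided. Hence at scale
  \<open>e\<close> only pairs that are far from each other, in either matching of their endpoints,
  are compared. Once nonzero distances determine their pairs, a loose embedding into the line
  amounts to a continuous injection onto a Sidon set, one in which the sum of two elements
  determines them. A zero-dimensional space maps onto such a set through digit expansions.\<close>

lemma gh_dist_le_map:
  assumes X: "compact_metric X" and Y: "compact_metric Y" and r: "0 < r"
    and f: "f \<in> mspace Y \<rightarrow> mspace X"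
    and distort: "\<And>y y'. y \<in> mspace Y \<Longrightarrow> y' \<in> mspace Y \<Longrightarrow>
        \<bar>mdist X (f y) (f y') - mdist Y y y'\<bar> \<le> 2 * r"
    and dense: "\<And>x. x \<in> mspace X \<Longrightarrow> \<exists>y\<in>mspace Y. mdist X x (f y) \<le> r"
  shows "gh_dist X Y \<le> 3 * r"
proof -
  \<comment> \<open>Glue the spaces along \<open>f\<close>: crossing between \<open>f b\<close> and
    \<open>b\<close> costs \<open>r\<close>. A path that crosses twice pays \<open>2 * r\<close>,
    which is exactly the allowed distortion, so the distances inside each space are not
    shortened.\<close>
  define c where "c x y = (INF b\<in>mspace Y. mdist X x (f b) + r + mdist Y b y)" for x y
  have neY: "mspace Y \<noteq> {}" using Y by (simp add: compact_metric_def)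
  have fX: "f y \<in> mspace X" if "y \<in> mspace Y" for y using f that by auto
  have lo: "c x y \<le> mdist X x (f b) + r + mdist Y b y" if "b \<in> mspace Y" for x y b
    unfolding c_def
    by (rule cINF_lower[OF bdd_belowI[of _ 0]]) (use that r in auto)
  have ge: "t \<le> c x y" if "\<And>b. b \<in> mspace Y \<Longrightarrow> t \<le> mdist X x (f b) + r + mdist Y b y" for t x y
    unfolding c_def using neY that by (intro cINF_greatest) auto
  have triX: "mdist X x z \<le> mdist X x y + mdist X y z"
    if "x \<in> mspace X" "y \<in> mspace X" "z \<in> mspace X" for x y z using that by (rule mdist_triangle)
  have triY: "mdist Y x z \<le> mdist Y x y + mdist Y y z"
    if "x \<in> mspace Y" "y \<in> mspace Y" "z \<in> mspace Y" for x y z using that by (rule mdist_triangle)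
  have pos: "r \<le> c x y" for x y by (rule ge) simp
  have "coupling X Y c"
    unfolding coupling_def
  proof (intro conjI ballI)
    fix x y show "0 \<le> c x y" using pos[of x y] r by linarith
  next
    fix x x' y assume *: "x \<in> mspace X" "x' \<in> mspace X" "y \<in> mspace Y"
    have "c x y - mdist X x x' \<le> c x' y"
    proof (rule ge)
      fix b assume b: "b \<in> mspace Y"
      show "c x y - mdist X x x' \<le> mdist X x' (f b) + r + mdist Y b y"
        using lo[OF b, of x y] triX[OF *(1,2) fX[OF b]] by linarith
    qed
    then show "c x y \<le> mdist X x x' + c x' y" by linarith
    have "mdist X x x' - c x' y \<le> c x y"
    proof (rule ge)
      fix b assume b: "b \<in> mspace Y"
      have "mdist X x x' - (mdist X x (f b) + r + mdist Y b y) \<le> c x' y"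
      proof (rule ge)
        fix a assume a: "a \<in> mspace Y"
        show "mdist X x x' - (mdist X x (f b) + r + mdist Y b y) \<le> mdist X x' (f a) + r + mdist Y a y"
          using triX[OF *(1) fX[OF b] *(2)] triX[OF fX[OF b] fX[OF a] *(2)] triY[OF b *(3) a]
            distort[OF b a] mdist_commute[of X x' "f a"] mdist_commute[of Y a y] by linarith
      qed
      then show "mdist X x x' - c x' y \<le> mdist X x (f b) + r + mdist Y b y" by linarith
    qed
    then show "mdist X x x' \<le> c x y + c x' y" by linarith
  next
    fix y y' x assume *: "y \<in> mspace Y" "y' \<in> mspace Y" "x \<in> mspace X"
    have "c x y - mdist Y y y' \<le> c x y'"
    proof (rule ge)
      fix b assume b: "b \<in> mspace Y"
      show "c x y - mdist Y y y' \<le> mdist X x (f b) + r + mdist Y b y'"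
        using lo[OF b, of x y] triY[OF b *(2,1)] mdist_commute[of Y y y'] by linarith
    qed
    then show "c x y \<le> mdist Y y y' + c x y'" by linarith
    have "mdist Y y y' - c x y' \<le> c x y"
    proof (rule ge)
      fix b assume b: "b \<in> mspace Y"
      have "mdist Y y y' - (mdist X x (f b) + r + mdist Y b y) \<le> c x y'"
      proof (rule ge)
        fix a assume a: "a \<in> mspace Y"
        show "mdist Y y y' - (mdist X x (f b) + r + mdist Y b y) \<le> mdist X x (f a) + r + mdist Y a y'"
          using triY[OF *(1) b *(2)] triY[OF b a *(2)] triX[OF fX[OF b] *(3) fX[OF a]]
            distort[OF b a] mdist_commute[of X x "f b"] mdist_commute[of Y b y] by linarith
      qed
      then show "mdist Y y y' - c x y' \<le> mdist X x (f b) + r + mdist Y b y" by linarith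
    qed
    then show "mdist Y y y' \<le> c x y + c x y'" by linarith
  qed
  then have "gh_dist X Y \<le> 3 * r + e" if e: "0 < e" for e
  proof (rule gh_dist_le[OF X Y])
    fix x assume "x \<in> mspace X"
    then obtain y where y: "y \<in> mspace Y" "mdist X x (f y) \<le> r" using dense by blast
    moreover have "mdist Y y y = 0" using y(1) by simp
    ultimately have "c x y < 3 * r + e" using lo[OF y(1), of x y] r e by linarith
    then show "\<exists>y\<in>mspace Y. c x y < 3 * r + e" using y(1) by blast
  next
    fix y assume y: "y \<in> mspace Y"
    have "mdist Y y y = 0" "mdist X (f y) (f y) = 0" using y fX[OF y] by simp_all
    then have "c (f y) y < 3 * r + e" using lo[OF y, of "f y" y] r e by linarith
    then show "\<exists>x\<in>mspace X. c x y < 3 * r + e" using fX[OF y] by blast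
  next
    show "0 < c x y" for x y using pos[of x y] r by linarith
  qed (use r e in simp)
  then show ?thesis by (rule field_le_epsilon)
qed

text \<open>The map goes from the nearby space \<open>Y\<close> back to \<open>X\<close>, so that
  labellings and inequalities on \<open>X\<close> can be pulled back to \<open>Y\<close>. Sending
  each point to a coupling partner works because every comparison of distances passes through two
  coupling values below \<open>r\<close>.\<close>

lemma gh_dist_less_map:
  assumes X: "compact_metric X" and Y: "compact_metric Y" and "gh_dist X Y < r"
  obtains f where "f \<in> mspace Y \<rightarrow> mspace X"
    "\<And>y y'. y \<in> mspace Y \<Longrightarrow> y' \<in> mspace Y \<Longrightarrow> \<bar>mdist X (f y) (f y') - mdist Y y y'\<bar> \<le> 2 * r"
proof -
  obtain c where c: "coupling X Y c" "\<forall>y\<in>mspace Y. \<exists>x\<in>mspace X. c x y < r"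
    using gh_dist_lessD[OF assms] by blast
  then obtain f where f: "\<And>y. y \<in> mspace Y \<Longrightarrow> f y \<in> mspace X \<and> c (f y) y < r" by metis
  show thesis
  proof
    show "f \<in> mspace Y \<rightarrow> mspace X" using f by auto
    fix y y' assume y: "y \<in> mspace Y" "y' \<in> mspace Y"
    then have fy: "f y \<in> mspace X" "f y' \<in> mspace X" "c (f y) y < r" "c (f y') y' < r" using f by auto
    show "\<bar>mdist X (f y) (f y') - mdist Y y y'\<bar> \<le> 2 * r"
      using fy couplingD(3)[OF c(1) fy(1) y(1) fy(2)] couplingD(4)[OF c(1) fy(2) y(1,2)]
        couplingD(5)[OF c(1) fy(1) y] couplingD(2)[OF c(1) fy(1) y(2) fy(2)] by linarith
  qed
qed

lemma open_class_predicate: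
  assumes "\<And>X. compact_metric X \<Longrightarrow> P X \<Longrightarrow>
      \<exists>r>0. \<forall>Y. compact_metric Y \<longrightarrow> gh_dist X Y < r \<longrightarrow> P Y"
  shows "open {p. P (rep_gh_space p)}"
  unfolding open_dist
proof
  fix p assume "p \<in> {p. P (rep_gh_space p)}"
  then obtain r where "r > 0" "\<forall>Y. compact_metric Y \<longrightarrow> gh_dist (rep_gh_space p) Y < r \<longrightarrow> P Y"
    using assms compact_metric_rep by blast
  then show "\<exists>e>0. \<forall>y. dist y p < e \<longrightarrow> y \<in> {p. P (rep_gh_space p)}"
    using compact_metric_rep by (auto simp: dist_gh_space_def gh_dist_commute)
qed

text \<open>Stability under perturbation contains isometry invariance: the chosen representative is
  at distance 0 from \<open>X\<close>, hence within every radius.\<close>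

lemma rep_gh_space_predicate:
  assumes "\<And>X. compact_metric X \<Longrightarrow> P X \<Longrightarrow>
      \<exists>r>0. \<forall>Y. compact_metric Y \<longrightarrow> gh_dist X Y < r \<longrightarrow> P Y"
    and X: "compact_metric X" and "P X"
  shows "P (rep_gh_space (isometry_class X))"
proof -
  let ?Y = "rep_gh_space (isometry_class X)"
  have "gh_dist X ?Y = 0"
    using gh_dist_isometric[OF X compact_metric_rep isometric_sym[OF isometric_rep_class[OF X]]] .
  then show ?thesis using assms(1)[OF X \<open>P X\<close>] compact_metric_rep by fastforce
qed

section \<open>Zero-dimensionality\<close>

text \<open>The labelling \<open>p\<close> encodes a partition into clopen fibres; on a compact
  space only finitely many labels occur. One slack \<open>\<delta>\<close> serves as gap between
  fibres and as margin in their diameter, so both halves survive a small distortion.\<close>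

definition separated :: "'a metric \<Rightarrow> real \<Rightarrow> bool" where
  "separated X e \<longleftrightarrow> (\<exists>\<delta>>0. \<exists>p :: 'a \<Rightarrow> nat. \<forall>x\<in>mspace X. \<forall>y\<in>mspace X.
     (mdist X x y \<le> \<delta> \<longrightarrow> p x = p y) \<and> (p x = p y \<longrightarrow> mdist X x y \<le> e - \<delta>))"

lemma has_cover_order_0_iff:
  "has_cover_order \<V> 0 \<longleftrightarrow> \<Union>\<V> \<noteq> {} \<and> disjoint \<V>"
proof -
  have "(\<exists>\<W>\<subseteq>\<V>. card \<W> = 0 + 1 \<and> \<Inter>\<W> \<noteq> {}) \<longleftrightarrow> \<Union>\<V> \<noteq> {}"
  proof
    assume "\<Union>\<V> \<noteq> {}"
    then obtain V where "V \<in> \<V>" "V \<noteq> {}" by blast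
    then show "\<exists>\<W>\<subseteq>\<V>. card \<W> = 0 + 1 \<and> \<Inter>\<W> \<noteq> {}" by (intro exI[of _ "{V}"]) auto
  qed (auto simp: card_1_singleton_iff)
  moreover have "(\<exists>\<W>\<subseteq>\<V>. card \<W> = 0 + 2 \<and> \<Inter>\<W> \<noteq> {}) \<longleftrightarrow> \<not> disjoint \<V>"
  proof
    assume "\<not> disjoint \<V>"
    then obtain U V where "U \<in> \<V>" "V \<in> \<V>" "U \<noteq> V" "U \<inter> V \<noteq> {}"
      by (auto simp: pairwise_def disjnt_def)
    then show "\<exists>\<W>\<subseteq>\<V>. card \<W> = 0 + 2 \<and> \<Inter>\<W> \<noteq> {}" by (intro exI[of _ "{U, V}"]) auto
  next
    assume "\<exists>\<W>\<subseteq>\<V>. card \<W> = 0 + 2 \<and> \<Inter>\<W> \<noteq> {}"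
    then obtain \<W> where \<W>: "\<W> \<subseteq> \<V>" "card \<W> = 2" "\<Inter>\<W> \<noteq> {}" unfolding add_0 by blast
    then obtain U V where "\<W> = {U, V}" "U \<noteq> V" unfolding card_2_iff by blast
    with \<W> have "{U, V} \<subseteq> \<V>" "U \<noteq> V" "\<Inter>{U, V} \<noteq> {}" by simp_all
    then show "\<not> disjoint \<V>" by (auto simp: pairwise_def disjnt_def)
  qed
  ultimately show ?thesis by (auto simp: has_cover_order_def)
qed

text \<open>A cover of a nonempty space has a nonempty member, so order exactly 0 reduces to
  disjointness, and there is no smaller dimension to exclude.\<close>

lemma has_covering_dim_0_iff:
  assumes "topspace X \<noteq> {}"
  shows "has_covering_dim X 0 \<longleftrightarrow> (\<forall>\<U>. finite_open_cover X \<U> \<longrightarrow>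
    (\<exists>\<V>. finite_open_cover X \<V> \<and> (\<forall>V\<in>\<V>. \<exists>U\<in>\<U>. V \<subseteq> U) \<and> disjoint \<V>))"
proof -
  have "has_cover_order \<V> 0 \<longleftrightarrow> disjoint \<V>" if "finite_open_cover X \<V>" for \<V>
    using that assms unfolding has_cover_order_0_iff by (simp add: finite_open_cover_def)
  then have "(finite_open_cover X \<V> \<and> R \<and> has_cover_order \<V> 0) \<longleftrightarrow> (finite_open_cover X \<V> \<and> R \<and> disjoint \<V>)"
    for \<V> R by blast
  then show ?thesis unfolding has_covering_dim_def covering_dim_le_def by simp
qed

text \<open>A disjoint open refinement of a cover by balls of radius \<open>e / 4\<close> supplies
  the labels. Its Lebesgue number bounds the gap between different members from below.\<close>

lemma zero_dim_imp_separated: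
  assumes X: "compact_metric X" and dim: "has_covering_dim (mtopology_of X) 0" and e: "0 < e"
  shows "separated X e"
proof -
  interpret Metric_space "mspace X" "mdist X" by simp
  have top: "mtopology_of X = mtopology" by (simp add: mtopology_of_def)
  have cX: "compactin mtopology (mspace X)" and ne: "mspace X \<noteq> {}"
    using X by (auto simp: compact_metric_def mtopology_of_def compact_space_def)
  have "topspace mtopology \<noteq> {}" using ne by simp
  then have "\<forall>\<U>. finite_open_cover mtopology \<U> \<longrightarrow> (\<exists>\<V>. finite_open_cover mtopology \<V> \<and>
      (\<forall>V\<in>\<V>. \<exists>U\<in>\<U>. V \<subseteq> U) \<and> disjoint \<V>)"
    using dim unfolding top by (rule has_covering_dim_0_iff[THEN iffD1])
  then have dim': "finite_open_cover mtopology \<U> \<Longrightarrow> \<exists>\<V>. finite_open_cover mtopology \<V> \<and>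
      (\<forall>V\<in>\<V>. \<exists>U\<in>\<U>. V \<subseteq> U) \<and> disjoint \<V>" for \<U>
    by blast
  have "mtotally_bounded (mspace X)" using cX by (rule compactin_imp_mtotally_bounded)
  then obtain K where K: "finite K" "K \<subseteq> mspace X" "mspace X \<subseteq> (\<Union>x\<in>K. mball x (e / 4))"
    using e unfolding mtotally_bounded_def by (metis divide_pos_pos zero_less_numeral)
  have cov: "finite_open_cover mtopology ((\<lambda>x. mball x (e / 4)) ` K)"
    unfolding finite_open_cover_def
  proof (intro conjI)
    show "\<Union> ((\<lambda>x. mball x (e / 4)) ` K) = topspace mtopology"
      using K(3) by (simp add: subset_antisym mball_subset_mspace UN_least)
  qed (use K(1) in auto)
  obtain \<V> where \<V>: "finite_open_cover mtopology \<V>" "disjoint \<V>"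
    "\<forall>V\<in>\<V>. \<exists>U\<in>(\<lambda>x. mball x (e / 4)) ` K. V \<subseteq> U"
    using dim'[OF cov] by meson
  have fin: "finite \<V>" and cover: "\<Union>\<V> = mspace X" and op: "\<And>V. V \<in> \<V> \<Longrightarrow> openin mtopology V"
    using \<V>(1) by (auto simp: finite_open_cover_def)
  have "\<exists>l>0. \<forall>x\<in>mspace X. \<exists>V\<in>\<V>. mball x l \<subseteq> V"
    by (rule lebesgue_number[OF cX]) (simp_all add: cover op)
  then obtain l where l: "l > 0" "\<And>x. x \<in> mspace X \<Longrightarrow> \<exists>V\<in>\<V>. mball x l \<subseteq> V" by meson
  define W where "W x = (THE V. V \<in> \<V> \<and> x \<in> V)" for x
  have W: "W x = V" if "V \<in> \<V>" "x \<in> V" for x V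
    unfolding W_def using that \<V>(2) by (intro the_equality conjI; meson disjnt_iff pairwiseD)
  define p where "p x = to_nat_on \<V> (W x)" for x
  have p: "p x = p y \<longleftrightarrow> W x = W y" if xy: "x \<in> mspace X" "y \<in> mspace X" for x y
  proof -
    obtain U V where "U \<in> \<V>" "x \<in> U" "V \<in> \<V>" "y \<in> V" using xy unfolding cover[symmetric] by blast
    then have "W x \<in> \<V>" "W y \<in> \<V>" using W by simp_all
    then show ?thesis using fin by (simp add: p_def countable_finite)
  qed
  \<comment> \<open>The half of \<open>l\<close> turns the non-strict bound \<open>\<delta>\<close>
    into membership in the open ball of radius \<open>l\<close>. Fibres have distances below
    \<open>e / 2\<close>, so subtracting \<open>e / 4\<close> from \<open>e\<close> leaves enough
    room.\<close>
  define \<delta> where "\<delta> = min (l / 2) (e / 4)"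
  have "\<delta> > 0" using l(1) e by (simp add: \<delta>_def)
  moreover have "p x = p y" if xy: "x \<in> mspace X" "y \<in> mspace X" "mdist X x y \<le> \<delta>" for x y
  proof -
    obtain V where "V \<in> \<V>" "mball x l \<subseteq> V" using l(2) xy(1) by blast
    moreover have "x \<in> mball x l" "y \<in> mball x l" using xy l(1) by (auto simp: \<delta>_def)
    ultimately have "x \<in> V" "y \<in> V" by blast+
    then show ?thesis using W[OF \<open>V \<in> \<V>\<close>] p[OF xy(1,2)] by simp
  qed
  moreover have "mdist X x y \<le> e - \<delta>" if xy: "x \<in> mspace X" "y \<in> mspace X" "p x = p y" for x y
  proof -
    obtain V where V: "V \<in> \<V>" "x \<in> V" using xy(1) cover by blast
    moreover obtain V' where "V' \<in> \<V>" "y \<in> V'" using xy(2) cover by blast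
    ultimately have "y \<in> V" using W p xy by metis
    obtain k where "V \<subseteq> mball k (e / 4)" using \<V>(3) V(1) by blast
    then have k: "k \<in> mspace X" "mdist X k x < e / 4" "mdist X k y < e / 4"
      using V(2) \<open>y \<in> V\<close> by (auto simp: subset_iff)
    then have "mdist X x y \<le> mdist X x k + mdist X k y" using xy by (intro mdist_triangle) auto
    moreover have "\<delta> \<le> e / 4" by (simp add: \<delta>_def)
    ultimately show ?thesis using k mdist_commute[of X x k] e by linarith
  qed
  ultimately show ?thesis unfolding separated_def by blast
qed

text \<open>Choose the scale below a Lebesgue number of the given cover: the fibres then refine it.
  They are open by the gap \<open>\<delta>\<close>, and finitely many suffice because every point
  shares its label with a point of a finite \<open>\<delta>\<close>-net.\<close>

lemma separated_imp_zero_dim: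
  assumes X: "compact_metric X" and sep: "\<And>n. separated X (inverse (real (Suc n)))"
  shows "has_covering_dim (mtopology_of X) 0"
proof -
  interpret Metric_space "mspace X" "mdist X" by simp
  have top: "mtopology_of X = mtopology" by (simp add: mtopology_of_def)
  have cX: "compactin mtopology (mspace X)" and ne: "mspace X \<noteq> {}"
    using X by (auto simp: compact_metric_def mtopology_of_def compact_space_def)
  show ?thesis unfolding top
  proof (subst has_covering_dim_0_iff, simp add: ne, intro allI impI)
    fix \<U> assume \<U>: "finite_open_cover mtopology \<U>"
    obtain l where l: "l > 0" "\<And>x. x \<in> mspace X \<Longrightarrow> \<exists>U\<in>\<U>. mball x l \<subseteq> U"
      using lebesgue_number[OF cX, of \<U>] \<U> by (auto simp: finite_open_cover_def)
    obtain n where n: "inverse (real (Suc n)) < l" using reals_Archimedean[OF l(1)] by auto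
    obtain \<delta> and p :: "'a \<Rightarrow> nat" where \<delta>: "\<delta> > 0" and
      p: "\<And>x y. x \<in> mspace X \<Longrightarrow> y \<in> mspace X \<Longrightarrow> mdist X x y \<le> \<delta> \<Longrightarrow> p x = p y"
        "\<And>x y. x \<in> mspace X \<Longrightarrow> y \<in> mspace X \<Longrightarrow> p x = p y \<Longrightarrow> mdist X x y \<le> inverse (real (Suc n)) - \<delta>"
      using sep[of n] unfolding separated_def by blast
    define V where "V x = {y \<in> mspace X. p y = p x}" for x
    obtain K where K: "finite K" "K \<subseteq> mspace X" "mspace X \<subseteq> (\<Union>x\<in>K. mball x \<delta>)"
      using compactin_imp_mtotally_bounded[OF cX] \<delta> unfolding mtotally_bounded_def by metis
    have "openin mtopology (V x)" for x
      unfolding openin_mtopology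
    proof (intro conjI allI impI)
      fix y assume y: "y \<in> V x"
      then have "mball y \<delta> \<subseteq> V x" using p(1)[of y] by (fastforce simp: V_def)
      then show "\<exists>r>0. mball y r \<subseteq> V x" using \<delta> by blast
    qed (auto simp: V_def)
    moreover have "mspace X \<subseteq> \<Union>(V ` K)"
    proof
      fix y assume y: "y \<in> mspace X"
      then obtain x where "x \<in> K" "x \<in> mspace X" "mdist X x y < \<delta>" using K by auto
      then have "x \<in> K" "y \<in> V x" using p(1)[of x y] y by (auto simp: V_def)
      then show "y \<in> \<Union>(V ` K)" by blast
    qed
    ultimately have "finite_open_cover mtopology (V ` K)"
      using K(1) by (auto simp: finite_open_cover_def V_def)
    moreover have "\<exists>U\<in>\<U>. V x \<subseteq> U" if x: "x \<in> K" for x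
    proof -
      have "x \<in> mspace X" using x K(2) by blast
      then obtain U where "U \<in> \<U>" "mball x l \<subseteq> U" using l(2) by meson
      moreover have "V x \<subseteq> mball x l"
        using p(2)[of x] n \<delta> x K(2) by (fastforce simp: V_def)
      ultimately show ?thesis by (meson subset_trans)
    qed
    moreover have "disjoint (V ` K)" by (auto simp: pairwise_def disjnt_def V_def)
    ultimately show "\<exists>\<V>. finite_open_cover mtopology \<V> \<and> (\<forall>V\<in>\<V>. \<exists>U\<in>\<U>. V \<subseteq> U) \<and> disjoint \<V>"
      by blast
  qed
qed

section \<open>Generic properties\<close>

lemma separated_perturb:
  fixes X :: "real metric"
  assumes X: "compact_metric X" and "separated X e"
  shows "\<exists>r>0. \<forall>Y. compact_metric Y \<longrightarrow> gh_dist X Y < r \<longrightarrow> separated Y e"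
proof -
  obtain \<delta> and p :: "real \<Rightarrow> nat" where \<delta>: "\<delta> > 0" and
    p: "\<And>x y. x \<in> mspace X \<Longrightarrow> y \<in> mspace X \<Longrightarrow> mdist X x y \<le> \<delta> \<Longrightarrow> p x = p y"
       "\<And>x y. x \<in> mspace X \<Longrightarrow> y \<in> mspace X \<Longrightarrow> p x = p y \<Longrightarrow> mdist X x y \<le> e - \<delta>"
    using assms(2) unfolding separated_def by blast
  \<comment> \<open>Radius \<open>\<delta> / 4\<close> means distortion at most
    \<open>\<delta> / 2\<close>, so the pulled back labelling keeps half of the slack in both
    conditions.\<close>
  have "separated Y e" if Y: "compact_metric Y" "gh_dist X Y < \<delta> / 4" for Y
  proof -
    obtain f where f: "f \<in> mspace Y \<rightarrow> mspace X" "\<And>y y'. y \<in> mspace Y \<Longrightarrow> y' \<in> mspace Y \<Longrightarrow>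
        \<bar>mdist X (f y) (f y') - mdist Y y y'\<bar> \<le> 2 * (\<delta> / 4)"
      using gh_dist_less_map[OF X Y] by blast
    have "(mdist Y y y' \<le> \<delta> / 2 \<longrightarrow> (p \<circ> f) y = (p \<circ> f) y') \<and>
        ((p \<circ> f) y = (p \<circ> f) y' \<longrightarrow> mdist Y y y' \<le> e - \<delta> / 2)"
      if y: "y \<in> mspace Y" "y' \<in> mspace Y" for y y'
    proof -
      have "f y \<in> mspace X" "f y' \<in> mspace X" using f(1) y by auto
      with f(2)[OF y] p[of "f y" "f y'"] show ?thesis unfolding o_apply by argo
    qed
    with \<delta> show ?thesis unfolding separated_def
      by (intro exI[of _ "\<delta> / 2"] conjI exI[of _ "p \<circ> f"] ballI) auto
  qed
  with \<delta> show ?thesis by (intro exI[of _ "\<delta> / 4"]) auto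
qed

text \<open>This makes loose embeddability a matter of the target alone: two equal distances then
  belong to the same pair or to two degenerate pairs.\<close>

definition distances_distinct :: "'a metric \<Rightarrow> bool" where
  "distances_distinct X \<longleftrightarrow> (\<forall>x\<in>mspace X. \<forall>x'\<in>mspace X. \<forall>z\<in>mspace X. \<forall>z'\<in>mspace X.
     x \<noteq> x' \<longrightarrow> mdist X x x' = mdist X z z' \<longrightarrow> {x, x'} = {z, z'})"

text \<open>The slack \<open>\<delta>\<close> makes this approximate version of the preceding property stable under small
  perturbations of the space.\<close>

definition distances_distinct_at :: "'a metric \<Rightarrow> real \<Rightarrow> bool" where
  "distances_distinct_at X e \<longleftrightarrow> (\<exists>\<delta>>0.
     \<forall>x\<in>mspace X. \<forall>x'\<in>mspace X. \<forall>z\<in>mspace X. \<forall>z'\<in>mspace X.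
       e - \<delta> < mdist X x x' \<longrightarrow> e - \<delta> < max (mdist X x z) (mdist X x' z') \<longrightarrow>
       e - \<delta> < max (mdist X x z') (mdist X x' z) \<longrightarrow>
       \<delta> < \<bar>mdist X x x' - mdist X z z'\<bar>)"

lemma distances_distinct_at_perturb:
  fixes X :: "real metric"
  assumes X: "compact_metric X" and "distances_distinct_at X e"
  shows "\<exists>r>0. \<forall>Y. compact_metric Y \<longrightarrow> gh_dist X Y < r \<longrightarrow> distances_distinct_at Y e"
proof -
  obtain \<delta> where \<delta>: "\<delta> > 0" and
    D: "\<And>x x' z z'. x \<in> mspace X \<Longrightarrow> x' \<in> mspace X \<Longrightarrow> z \<in> mspace X \<Longrightarrow> z' \<in> mspace X \<Longrightarrow>
       e - \<delta> < mdist X x x' \<Longrightarrow> e - \<delta> < max (mdist X x z) (mdist X x' z') \<Longrightarrow>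
       e - \<delta> < max (mdist X x z') (mdist X x' z) \<Longrightarrow>
       \<delta> < \<bar>mdist X x x' - mdist X z z'\<bar>"
    using assms(2) unfolding distances_distinct_at_def by blast
  \<comment> \<open>The conclusion compares two distances, each moved by at most
    \<open>\<delta> / 4\<close>, so their difference moves by at most
    \<open>\<delta> / 2\<close>.\<close>
  have "distances_distinct_at Y e" if Y: "compact_metric Y" "gh_dist X Y < \<delta> / 8" for Y
  proof -
    obtain f where f: "f \<in> mspace Y \<rightarrow> mspace X" "\<And>y y'. y \<in> mspace Y \<Longrightarrow> y' \<in> mspace Y \<Longrightarrow>
        \<bar>mdist X (f y) (f y') - mdist Y y y'\<bar> \<le> 2 * (\<delta> / 8)"
      using gh_dist_less_map[OF X Y] by blast
    have "\<delta> / 2 < \<bar>mdist Y x x' - mdist Y z z'\<bar>"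
      if in_Y: "x \<in> mspace Y" "x' \<in> mspace Y" "z \<in> mspace Y" "z' \<in> mspace Y"
        and far: "e - \<delta> / 2 < mdist Y x x'" "e - \<delta> / 2 < max (mdist Y x z) (mdist Y x' z')"
          "e - \<delta> / 2 < max (mdist Y x z') (mdist Y x' z)" for x x' z z'
    proof -
      have fX: "f x \<in> mspace X" "f x' \<in> mspace X" "f z \<in> mspace X" "f z' \<in> mspace X"
        using f(1) in_Y by auto
      note d = f(2)[OF in_Y(1,2)] f(2)[OF in_Y(3,4)] f(2)[OF in_Y(1,3)] f(2)[OF in_Y(2,4)]
        f(2)[OF in_Y(1,4)] f(2)[OF in_Y(2,3)]
      have "e - \<delta> < mdist X (f x) (f x')" using d(1) far(1) \<delta> by linarith
      moreover have "e - \<delta> < max (mdist X (f x) (f z)) (mdist X (f x') (f z'))"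
        using d(3,4) far(2) \<delta> by linarith
      moreover have "e - \<delta> < max (mdist X (f x) (f z')) (mdist X (f x') (f z))"
        using d(5,6) far(3) \<delta> by linarith
      ultimately have "\<delta> < \<bar>mdist X (f x) (f x') - mdist X (f z) (f z')\<bar>" by (rule D[OF fX])
      then show ?thesis using d(1,2) by linarith
    qed
    with \<delta> show ?thesis unfolding distances_distinct_at_def by (intro exI[of _ "\<delta> / 2"]) auto
  qed
  with \<delta> show ?thesis by (intro exI[of _ "\<delta> / 8"]) auto
qed

lemma distances_distinct_at_imp:
  assumes "\<And>n. distances_distinct_at X (inverse (real (Suc n)))"
  shows "distances_distinct X"
  unfolding distances_distinct_def
proof (intro ballI impI, rule ccontr)
  fix x x' z z'
  assume in_X: "x \<in> mspace X" "x' \<in> mspace X" "z \<in> mspace X" "z' \<in> mspace X"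
    and ne: "x \<noteq> x'" and eq: "mdist X x x' = mdist X z z'" and pair: "{x, x'} \<noteq> {z, z'}"
  \<comment> \<open>The two maxima measure how far each matching of the pairs is from the identity.
    Different pairs make both positive, so at any scale below \<open>m\<close> the quadruple falls
    under the approximate condition.\<close>
  define m where "m = min (mdist X x x') (min (max (mdist X x z) (mdist X x' z'))
      (max (mdist X x z') (mdist X x' z)))"
  have pos: "0 < mdist X a b" if "a \<in> mspace X" "b \<in> mspace X" "a \<noteq> b" for a b
    using that by (simp add: order_less_le)
  have "m > 0"
    using pair ne in_X pos unfolding m_def min_less_iff_conj less_max_iff_disj by (metis insert_commute)
  then obtain n where n: "inverse (real (Suc n)) < m" using reals_Archimedean by blast
  obtain \<delta> where "\<delta> > 0" and D: "inverse (real (Suc n)) - \<delta> < mdist X x x' \<Longrightarrow>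
      inverse (real (Suc n)) - \<delta> < max (mdist X x z) (mdist X x' z') \<Longrightarrow>
      inverse (real (Suc n)) - \<delta> < max (mdist X x z') (mdist X x' z) \<Longrightarrow>
      \<delta> < \<bar>mdist X x x' - mdist X z z'\<bar>"
    using assms[of n] in_X unfolding distances_distinct_at_def by blast
  have "inverse (real (Suc n)) < mdist X x x'"
      "inverse (real (Suc n)) < max (mdist X x z) (mdist X x' z')"
      "inverse (real (Suc n)) < max (mdist X x z') (mdist X x' z)"
    using n unfolding m_def min_less_iff_conj by blast+
  then have "\<delta> < \<bar>mdist X x x' - mdist X z z'\<bar>" using \<open>\<delta> > 0\<close> by (intro D) linarith+
  then show False using eq \<open>\<delta> > 0\<close> by simp
qed

section \<open>Finite spaces and their density\<close>

lemma finite_positive_lower_bound: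
  assumes "finite (S :: real set)" "\<forall>s\<in>S. 0 < s"
  shows "\<exists>\<delta>>0. \<forall>s\<in>S. \<delta> < s"
proof (intro exI[of _ "Min (insert 1 S) / 2"] conjI ballI)
  have pos: "0 < Min (insert 1 S)" using assms by simp
  then show "0 < Min (insert 1 S) / 2" by simp
  fix s assume "s \<in> S"
  then have "Min (insert 1 S) \<le> s" using assms(1) by simp
  then show "Min (insert 1 S) / 2 < s" using pos by linarith
qed

lemma finite_imp_separated:
  assumes fin: "finite (mspace X)" and e: "0 < e"
  shows "separated X e"
proof -
  \<comment> \<open>Below all nonzero distances, \<open>\<delta>\<close> makes every fibre a
    singleton; below \<open>e\<close>, it leaves \<open>e - \<delta>\<close> positive, as the
    diameter bound for singletons requires.\<close>
  define S where "S = insert e ((\<lambda>(x, y). mdist X x y) ` (mspace X \<times> mspace X) - {0})"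
  have "finite S" using fin by (simp add: S_def)
  moreover have "\<forall>s\<in>S. 0 < s" using e by (auto simp: S_def order_less_le)
  ultimately obtain \<delta> where \<delta>: "0 < \<delta>" "\<And>s. s \<in> S \<Longrightarrow> \<delta> < s"
    using finite_positive_lower_bound by meson
  have "\<delta> < e" by (rule \<delta>(2)) (simp add: S_def)
  have inj: "inj_on (to_nat_on (mspace X)) (mspace X)"
    by (rule inj_on_to_nat_on[OF countable_finite[OF fin]])
  have "(mdist X x y \<le> \<delta> \<longrightarrow> to_nat_on (mspace X) x = to_nat_on (mspace X) y) \<and>
      (to_nat_on (mspace X) x = to_nat_on (mspace X) y \<longrightarrow> mdist X x y \<le> e - \<delta>)"
    if xy: "x \<in> mspace X" "y \<in> mspace X" for x y
  proof (cases "x = y")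
    case True
    then have "mdist X x y = 0" using xy by simp
    with True show ?thesis using \<open>\<delta> < e\<close> by simp
  next
    case False
    then have "\<delta> < mdist X x y" using xy by (intro \<delta>(2)) (auto simp: S_def)
    then show ?thesis using inj xy False by (auto dest: inj_onD)
  qed
  then show ?thesis using \<delta>(1) unfolding separated_def by blast
qed

lemma finite_imp_distances_distinct_at:
  assumes fin: "finite (mspace X)" and dd: "distances_distinct X" and e: "0 < e"
  shows "distances_distinct_at X e"
proof -
  define D where "D = (\<lambda>(x, y). mdist X x y) ` (mspace X \<times> mspace X)"
  \<comment> \<open>The nonzero gaps between distances bound \<open>\<delta>\<close>, and
    \<open>e\<close> is added so that the threshold \<open>e - \<delta>\<close> stays positive and
    rules out coinciding pairs.\<close>
  define S where "S = insert e ((\<lambda>(s, t). \<bar>s - t\<bar>) ` (D \<times> D) - {0})"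
  have "finite S" using fin by (simp add: S_def D_def)
  moreover have "\<forall>s\<in>S. 0 < s" using e by (auto simp: S_def)
  ultimately obtain \<delta> where \<delta>: "0 < \<delta>" "\<And>s. s \<in> S \<Longrightarrow> \<delta> < s"
    using finite_positive_lower_bound by meson
  have "\<delta> < e" by (rule \<delta>(2)) (simp add: S_def)
  have "\<delta> < \<bar>mdist X x x' - mdist X z z'\<bar>"
    if in_X: "x \<in> mspace X" "x' \<in> mspace X" "z \<in> mspace X" "z' \<in> mspace X"
      and far: "e - \<delta> < mdist X x x'" "e - \<delta> < max (mdist X x z) (mdist X x' z')"
        "e - \<delta> < max (mdist X x z') (mdist X x' z)" for x x' z z'
  proof -
    have "mdist X x x = 0" "mdist X x' x' = 0" using in_X by simp_all
    then have "x \<noteq> x'" "x \<noteq> z \<or> x' \<noteq> z'" "x \<noteq> z' \<or> x' \<noteq> z"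
      using far \<open>\<delta> < e\<close> by (metis max.idem diff_gt_0_iff_gt order_less_asym)+
    then have "mdist X x x' \<noteq> mdist X z z'"
      using dd in_X unfolding distances_distinct_def by (metis doubleton_eq_iff)
    moreover have "mdist X x x' \<in> D" "mdist X z z' \<in> D" using in_X by (auto simp: D_def)
    ultimately have "\<bar>mdist X x x' - mdist X z z'\<bar> \<in> S" by (auto simp: S_def)
    then show ?thesis by (rule \<delta>(2))
  qed
  then show ?thesis using \<delta>(1) unfolding distances_distinct_at_def by blast
qed

lemma finite_imp_compact_metric:
  assumes "finite (mspace X)" "mspace X \<noteq> {}"
  shows "compact_metric X"
proof -
  have "compactin (mtopology_of X) (topspace (mtopology_of X))"
    using assms(1) by (intro finite_imp_compactin) auto
  then show ?thesis using assms(2) by (simp add: compact_metric_def compact_space_def)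
qed

text \<open>On a finite \<open>r\<close>-net every nonzero distance is raised by \<open>r\<close>
  plus \<open>h\<close> times an index of the pair, an amount between \<open>r\<close> and
  \<open>2 * r\<close>. The triangle inequality survives: one side gains at most
  \<open>2 * r\<close>, the other, being a sum of two raised distances, at least
  \<open>2 * r\<close>.\<close>

lemma compact_metric_approx_finite:
  assumes X: "compact_metric X" and e: "0 < e"
  obtains Y where "finite (mspace Y)" "compact_metric Y" "distances_distinct Y" "gh_dist X Y < e"
proof -
  interpret Metric_space "mspace X" "mdist X" by simp
  define r where "r = e / 4"
  have r: "0 < r" using e by (simp add: r_def)
  have cX: "compactin mtopology (mspace X)" and ne: "mspace X \<noteq> {}"
    using X by (auto simp: compact_metric_def mtopology_of_def compact_space_def)
  obtain F where F: "finite F" "F \<subseteq> mspace X" "mspace X \<subseteq> (\<Union>x\<in>F. mball x r)"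
    using compactin_imp_mtotally_bounded[OF cX] r unfolding mtotally_bounded_def by metis
  then have F_ne: "F \<noteq> {}" using ne by auto
  define P where "P = (\<lambda>(x, y). {x, y}) ` (F \<times> F)"
  have "finite P" using F(1) by (simp add: P_def)
  then have inj: "inj_on (to_nat_on P) P" by (intro inj_on_to_nat_on countable_finite)
  define i where "i x y = real (to_nat_on P {x, y})" for x y
  have i_commute: "i x y = i y x" for x y by (simp add: i_def insert_commute)
  have i_eq: "{x, y} = {z, w}" if "i x y = i z w" "x \<in> F" "y \<in> F" "z \<in> F" "w \<in> F" for x y z w
    by (rule inj_onD[OF inj]) (use that in \<open>auto simp: i_def P_def\<close>)
  define N where "N = Max (insert 0 (to_nat_on P ` P))"
  have i_le: "i x y \<le> N" if "x \<in> F" "y \<in> F" for x y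
    using that \<open>finite P\<close> by (auto simp: i_def N_def P_def intro!: Max_ge)
  define D where "D = (\<lambda>(x, y). mdist X x y) ` (F \<times> F)"
  define J where "J = (\<lambda>(x, y). i x y) ` (F \<times> F)"
  \<comment> \<open>These are the values of \<open>h\<close> for which
    \<open>s + h * j = t + h * k\<close> with different indices. Equal indices contribute only
    division by zero, that is 0, which a positive \<open>h\<close> avoids anyway.\<close>
  define B where "B = (\<lambda>((s, t), (j, k)). (t - s) / (j - k)) ` ((D \<times> D) \<times> (J \<times> J))"
  have "finite B" using F(1) by (simp add: B_def D_def J_def)
  moreover have "infinite {0<..<r / (real N + 1)}" using r by (simp add: infinite_Ioo)
  ultimately obtain h where h: "h \<in> {0<..<r / (real N + 1)}" "h \<notin> B"
    by (meson finite_subset subsetI)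
  then have h_pos: "0 < h" and "h * (real N + 1) < r" by (auto simp: field_simps)
  have hi: "0 \<le> h * i x y" "h * i x y \<le> r" if "x \<in> F" "y \<in> F" for x y
  proof -
    have "h * i x y \<le> h * (real N + 1)" using i_le[OF that] h_pos by (intro mult_left_mono) auto
    then show "h * i x y \<le> r" using \<open>h * (real N + 1) < r\<close> by linarith
    show "0 \<le> h * i x y" using h_pos by (simp add: i_def)
  qed
  define d where "d x y = (if x = y then 0 else mdist X x y + (r + h * \<bar>i x y\<bar>))" for x y
  have i_abs: "\<bar>i x y\<bar> = i x y" for x y by (simp add: i_def)
  interpret F: Metric_space F d
  proof
    show "0 \<le> d x y" for x y using r h_pos by (simp add: d_def add_nonneg_nonneg)
    show "d x y = d y x" for x y by (simp add: d_def i_commute mdist_commute)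
  next
    fix x y assume "x \<in> F" "y \<in> F"
    then show "d x y = 0 \<longleftrightarrow> x = y"
      using r hi(1)[of x y] nonneg[of x y] unfolding d_def i_abs by (smt (verit))
  next
    fix x y z assume xyz: "x \<in> F" "y \<in> F" "z \<in> F"
    have "mdist X x z \<le> mdist X x y + mdist X y z" using F(2) xyz by (intro triangle) auto
    moreover have "0 \<le> d x y" "0 \<le> d y z"
      using r hi(1) xyz by (auto simp: d_def i_abs)
    ultimately show "d x z \<le> d x y + d y z"
      using r hi[OF xyz(1,2)] hi[OF xyz(2,3)] hi[OF xyz(1,3)]
      by (cases "x = y"; cases "y = z"; cases "x = z") (simp_all add: d_def i_abs)
  qed
  define Y where "Y = metric (F, d)"
  have Y: "mspace Y = F" "mdist Y = d" by (auto simp: Y_def)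
  have cY: "compact_metric Y" using F(1) F_ne by (intro finite_imp_compact_metric) (auto simp: Y)
  show thesis
  proof
    show "finite (mspace Y)" using F(1) by (simp add: Y)
    show "compact_metric Y" by fact
    show "distances_distinct Y"
      unfolding distances_distinct_def Y
    proof (intro ballI impI)
      fix x x' z z' assume *: "x \<in> F" "x' \<in> F" "z \<in> F" "z' \<in> F" "x \<noteq> x'" "d x x' = d z z'"
      then have "z \<noteq> z'" by (metis F.zero)
      then have eq: "mdist X x x' + h * i x x' = mdist X z z' + h * i z z'"
        using * by (simp add: d_def i_abs)
      show "{x, x'} = {z, z'}"
      proof (rule i_eq, rule ccontr)
        assume "i x x' \<noteq> i z z'"
        then have "h = (mdist X z z' - mdist X x x') / (i x x' - i z z')"
          using eq by (simp add: field_simps)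
        moreover have "mdist X x x' \<in> D" "mdist X z z' \<in> D" "i x x' \<in> J" "i z z' \<in> J"
          using * by (auto simp: D_def J_def)
        then have "(mdist X z z' - mdist X x x') / (i x x' - i z z') \<in> B"
          unfolding B_def
          by (intro image_eqI[of _ _ "((mdist X x x', mdist X z z'), (i x x', i z z'))"]) auto
        ultimately show False using h(2) by simp
      qed (use * in auto)
    qed
    have "gh_dist X Y \<le> 3 * r"
    proof (rule gh_dist_le_map[OF X cY r, of id])
      show "id \<in> mspace Y \<rightarrow> mspace X" using F(2) by (auto simp: Y)
    next
      fix y y' assume y: "y \<in> mspace Y" "y' \<in> mspace Y"
      then have "mdist X y y' = 0" if "y = y'" using that F(2) by (auto simp: Y)
      with y show "\<bar>mdist X (id y) (id y') - mdist Y y y'\<bar> \<le> 2 * r"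
        using r hi[of y y'] unfolding Y d_def i_abs id_apply by auto
    next
      fix x assume "x \<in> mspace X"
      then obtain y where "y \<in> F" "mdist X y x < r" using F(3) by auto
      then show "\<exists>y\<in>mspace Y. mdist X x (id y) \<le> r"
        by (intro bexI[of _ y]) (auto simp: Y mdist_commute)
    qed
    then show "gh_dist X Y < e" using e by (simp add: r_def)
  qed
qed

section \<open>Completeness of the Gromov-Hausdorff space\<close>

lemma tendsto_geometric_half: "(\<lambda>k. C * (1/2) ^ k :: real) \<longlonglongrightarrow> 0"
  using tendsto_mult_right_zero[OF LIMSEQ_realpow_zero[of "1/2::real"], of C] by simp

text \<open>The intervals around \<open>a k\<close> of radius \<open>4 * (1/2) ^ k\<close> are
  nested: passing to the next one halves the radius and so frees \<open>2 * (1/2) ^ k\<close>, just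
  the permitted drift.\<close>

lemma geometric_drift_limit:
  fixes a :: "nat \<Rightarrow> real"
  assumes "\<And>k. \<bar>a (Suc k) - a k\<bar> \<le> 2 * (1/2) ^ k"
  shows "\<exists>l. a \<longlonglongrightarrow> l \<and> (\<forall>k. \<bar>a k - l\<bar> \<le> 4 * (1/2) ^ k)"
proof -
  note 0 = tendsto_geometric_half[of 4]
  have "\<exists>l. ((\<forall>k. a k - 4 * (1/2) ^ k \<le> l) \<and> (\<lambda>k. a k - 4 * (1/2) ^ k) \<longlonglongrightarrow> l) \<and>
      ((\<forall>k. l \<le> a k + 4 * (1/2) ^ k) \<and> (\<lambda>k. a k + 4 * (1/2) ^ k) \<longlonglongrightarrow> l)"
  proof (rule nested_sequence_unique)
    have "a k - 4 * (1/2) ^ k \<le> a (Suc k) - 4 * (1/2) ^ Suc k"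
      "a (Suc k) + 4 * (1/2) ^ Suc k \<le> a k + 4 * (1/2) ^ k" for k
      using assms[of k] by (simp_all add: abs_le_iff)
    then show "\<forall>k. a k - 4 * (1/2) ^ k \<le> a (Suc k) - 4 * (1/2) ^ Suc k"
      "\<forall>k. a (Suc k) + 4 * (1/2) ^ Suc k \<le> a k + 4 * (1/2) ^ k" by blast+
    show "\<forall>k. a k - 4 * (1/2) ^ k \<le> a k + 4 * (1/2) ^ k" by simp
    show "(\<lambda>k. (a k - 4 * (1/2) ^ k) - (a k + 4 * (1/2) ^ k)) \<longlonglongrightarrow> 0"
      using tendsto_mult_right_zero[OF 0, of "-2"] by (simp add: algebra_simps)
  qed
  then obtain l where l: "\<And>k. a k - 4 * (1/2) ^ k \<le> l" "\<And>k. l \<le> a k + 4 * (1/2) ^ k"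
    "(\<lambda>k. a k - 4 * (1/2) ^ k) \<longlonglongrightarrow> l" by blast
  have "a \<longlonglongrightarrow> l" using tendsto_add[OF l(3) 0] by simp
  moreover have "\<bar>a k - l\<bar> \<le> 4 * (1/2) ^ k" for k using l(1,2)[of k] by linarith
  ultimately show ?thesis by blast
qed

text \<open>From position \<open>m\<close> onwards this is dependent choice. The positions before
  \<open>m\<close> are filled backwards by induction, shifting \<open>A\<close> and \<open>R\<close>
  by one and prepending a predecessor.\<close>

lemma thread_through:
  assumes "\<And>k a. A k a \<Longrightarrow> \<exists>b. A (Suc k) b \<and> R k a b"
    and "\<And>k b. A (Suc k) b \<Longrightarrow> \<exists>a. A k a \<and> R k a b" and "A m a"
  shows "\<exists>x. x m = a \<and> (\<forall>k. A k (x k) \<and> R k (x k) (x (Suc k)))"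
  using assms
proof (induction m arbitrary: A R)
  case 0
  have "\<exists>x. \<forall>k. (A k (x k) \<and> (k = 0 \<longrightarrow> x k = a)) \<and> R k (x k) (x (Suc k))"
    by (rule dependent_nat_choice) (use 0 in auto)
  then show ?case by metis
next
  case (Suc m)
  have "\<exists>x. x m = a \<and> (\<forall>k. A (Suc k) (x k) \<and> R (Suc k) (x k) (x (Suc k)))"
    by (rule Suc.IH) (fact Suc.prems)+
  then obtain x where x: "x m = a" "\<And>k. A (Suc k) (x k) \<and> R (Suc k) (x k) (x (Suc k))" by blast
  obtain b where b: "A 0 b" "R 0 b (x 0)" using Suc.prems(2) x(2) by blast
  have "A k (case_nat b x k) \<and> R k (case_nat b x k) (case_nat b x (Suc k))" for k
    using x(2) b by (cases k) simp_all
  with x(1) show ?case by (intro exI[of _ "case_nat b x"]) simp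
qed

lemma coupling_Lipschitz:
  assumes c: "coupling X Y c" and "x \<in> mspace X" "x' \<in> mspace X" "y \<in> mspace Y" "y' \<in> mspace Y"
  shows "\<bar>c x y - c x' y'\<bar> \<le> mdist X x x' + mdist Y y y'"
  using couplingD(2)[OF c, of x y x'] couplingD(2)[OF c, of x' y' x] couplingD(4)[OF c, of x' y y']
    couplingD(4)[OF c, of x y' y] assms(2-) mdist_commute[of X x x'] mdist_commute[of Y y y']
  by linarith

text \<open>The limit consists of the threads \<open>x\<close> with \<open>x k \<in> X k\<close> whose consecutive members are
  within the coupling bound, with distance the limit of the coordinate distances, modulo distance
  zero; compactness is inherited from the product of the \<open>X k\<close>.\<close>

lemma gh_fast_Cauchy_limit:
  fixes X :: "nat \<Rightarrow> real metric"
  assumes X: "\<And>k. compact_metric (X k)" and close: "\<And>k. gh_dist (X k) (X (Suc k)) < (1/2) ^ k"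
  obtains Y where "compact_metric Y" "\<And>m. gh_dist (X m) Y \<le> 12 * (1/2) ^ m"
proof -
  have "\<exists>c. coupling (X k) (X (Suc k)) c \<and>
      (\<forall>x\<in>mspace (X k). \<exists>y\<in>mspace (X (Suc k)). c x y < (1/2) ^ k) \<and>
      (\<forall>y\<in>mspace (X (Suc k)). \<exists>x\<in>mspace (X k). c x y < (1/2) ^ k)" for k
    by (rule gh_dist_lessD[OF X X close])
  then obtain c where c: "\<And>k. coupling (X k) (X (Suc k)) (c k)"
    and fwd: "\<And>k. \<forall>x\<in>mspace (X k). \<exists>y\<in>mspace (X (Suc k)). c k x y < (1/2) ^ k"
    and bwd: "\<And>k. \<forall>y\<in>mspace (X (Suc k)). \<exists>x\<in>mspace (X k). c k x y < (1/2) ^ k"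
    by metis
  \<comment> \<open>The non-strict bound makes \<open>S\<close> closed in the product, hence
    compact.\<close>
  define S where "S = {x. \<forall>k. x k \<in> mspace (X k) \<and> c k (x k) (x (Suc k)) \<le> (1/2) ^ k}"
  have SX: "x k \<in> mspace (X k)" and Sc: "c k (x k) (x (Suc k)) \<le> (1/2) ^ k" if "x \<in> S" for x k
    using that by (auto simp: S_def)
  have S_through: "\<exists>x\<in>S. x m = a" if "a \<in> mspace (X m)" for m a
  proof -
    have "\<exists>x. x m = a \<and> (\<forall>k. x k \<in> mspace (X k) \<and> c k (x k) (x (Suc k)) \<le> (1/2) ^ k)"
      by (rule thread_through) (use that fwd bwd less_imp_le in meson)+
    then show ?thesis by (auto simp: S_def)
  qed

  define P where "P = product_topology (\<lambda>k. mtopology_of (X k)) UNIV"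
  have topP: "topspace P = {x. \<forall>k. x k \<in> mspace (X k)}"
    by (auto simp: P_def PiE_def)
  have compP: "compact_space P"
    using X by (simp add: P_def compact_space_product_topology compact_metric_def)
  have open_near: "openin P {y \<in> topspace P. mdist (X k) (x k) (y k) < e}" if "x \<in> topspace P" for x k e
  proof -
    have "continuous_map P euclidean (\<lambda>y. mdist (X k) (x k) (y k))"
    proof (rule continuous_map_mdist)
      show "continuous_map P (mtopology_of (X k)) (\<lambda>y. y k)"
        unfolding P_def by (rule continuous_map_product_projection) simp
      show "continuous_map P (mtopology_of (X k)) (\<lambda>y. x k)"
        using that by (simp add: topP)
    qed
    then have "openin P {y \<in> topspace P. mdist (X k) (x k) (y k) \<in> {..<e}}"
      by (rule openin_continuous_map_preimage) simp
    then show ?thesis by simp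
  qed
  have cont: "continuous_map P euclidean (\<lambda>x. c k (x k) (x (Suc k)))" for k
    unfolding mtopology_is_euclidean[symmetric] Met_TC.continuous_map_to_metric
  proof (intro ballI allI impI)
    fix x and e :: real assume x: "x \<in> topspace P" and e: "0 < e"
    let ?V = "\<lambda>k. {y \<in> topspace P. mdist (X k) (x k) (y k) < e / 2}"
    have "openin P (?V k \<inter> ?V (Suc k))" by (intro openin_Int open_near x)
    moreover have "mdist (X k) (x k) (x k) = 0" for k using x by (simp add: topP)
    then have "x \<in> ?V k \<inter> ?V (Suc k)" using x e by simp
    moreover have "c k (y k) (y (Suc k)) \<in> Met_TC.mball (c k (x k) (x (Suc k))) e"
      if y: "y \<in> ?V k \<inter> ?V (Suc k)" for y
    proof -
      have "\<bar>c k (x k) (x (Suc k)) - c k (y k) (y (Suc k))\<bar>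
          \<le> mdist (X k) (x k) (y k) + mdist (X (Suc k)) (x (Suc k)) (y (Suc k))"
        using x y by (intro coupling_Lipschitz c) (auto simp: topP)
      also have "\<dots> < e" using y by simp
      finally show ?thesis by (simp add: dist_real_def)
    qed
    ultimately show "\<exists>U. openin P U \<and> x \<in> U \<and>
        (\<forall>y\<in>U. c k (y k) (y (Suc k)) \<in> Met_TC.mball (c k (x k) (x (Suc k))) e)" by blast
  qed
  have "closedin P {x \<in> topspace P. c k (x k) (x (Suc k)) \<in> {..(1/2) ^ k}}" for k
    using cont by (rule closedin_continuous_map_preimage) simp
  then have "closedin P (\<Inter>k. {x \<in> topspace P. c k (x k) (x (Suc k)) \<in> {..(1/2) ^ k}})"
    by (intro closedin_Inter) auto
  also have "(\<Inter>k. {x \<in> topspace P. c k (x k) (x (Suc k)) \<in> {..(1/2) ^ k}}) = S"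
    by (auto simp: S_def topP)
  finally have compS: "compact_space (subtopology P S)"
    using compP by (intro compact_space_subtopology closedin_compact_space)
  have topS: "topspace (subtopology P S) = S" using SX by (auto simp: topP)

  \<comment> \<open>Consecutive coordinate distances differ by at most two coupling values, each at
    most \<open>(1/2) ^ k\<close> along a thread. The limit therefore exists with an error bound
    uniform over all threads.\<close>
  define D where "D x y = lim (\<lambda>k. mdist (X k) (x k) (y k))" for x y
  have D: "(\<lambda>k. mdist (X k) (x k) (y k)) \<longlonglongrightarrow> D x y"
    "\<bar>mdist (X k) (x k) (y k) - D x y\<bar> \<le> 4 * (1/2) ^ k" if xy: "x \<in> S" "y \<in> S" for x y k
  proof -
    have "\<bar>mdist (X (Suc k)) (x (Suc k)) (y (Suc k)) - mdist (X k) (x k) (y k)\<bar> \<le> 2 * (1/2) ^ k" for k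
    proof -
      note XY = SX[OF xy(1)] SX[OF xy(2)]
      show ?thesis
        using couplingD(3)[OF c[of k] XY(1) XY(1) XY(2)] couplingD(4)[OF c[of k] XY(2) XY(1) XY(2)]
          couplingD(5)[OF c[of k] XY(1) XY(1) XY(2)] couplingD(2)[OF c[of k] XY(1) XY(2) XY(2)]
          Sc[OF xy(1), of k] Sc[OF xy(2), of k] by linarith
    qed
    then obtain l where l: "(\<lambda>k. mdist (X k) (x k) (y k)) \<longlonglongrightarrow> l"
      "\<And>k. \<bar>mdist (X k) (x k) (y k) - l\<bar> \<le> 4 * (1/2) ^ k"
      using geometric_drift_limit[of "\<lambda>k. mdist (X k) (x k) (y k)"] by blast
    have "D x y = l" unfolding D_def using l(1) by (rule limI)
    with l show "(\<lambda>k. mdist (X k) (x k) (y k)) \<longlonglongrightarrow> D x y"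
      "\<bar>mdist (X k) (x k) (y k) - D x y\<bar> \<le> 4 * (1/2) ^ k" by auto
  qed
  have D_nonneg: "0 \<le> D x y" if "x \<in> S" "y \<in> S" for x y
    using D(1)[OF that] by (rule LIMSEQ_le_const) simp
  have D_commute: "D x y = D y x" for x y by (simp add: D_def mdist_commute)
  have D_refl: "D x x = 0" if "x \<in> S" for x
  proof -
    have "(\<lambda>k. mdist (X k) (x k) (x k)) = (\<lambda>k. 0)" using SX[OF that] by (intro ext) simp
    then show ?thesis using D(1)[OF that that] by (simp add: LIMSEQ_const_iff)
  qed
  have D_triangle: "D x z \<le> D x y + D y z" if "x \<in> S" "y \<in> S" "z \<in> S" for x y z
  proof (rule LIMSEQ_le[OF D(1) tendsto_add[OF D(1) D(1)]])
    show "\<exists>N. \<forall>k\<ge>N. mdist (X k) (x k) (z k) \<le> mdist (X k) (x k) (y k) + mdist (X k) (y k) (z k)"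
      using that SX by (intro exI allI impI mdist_triangle)
  qed (use that in auto)

  \<comment> \<open>The choice depends only on the class of threads at distance zero, so the
    quotient is realised as a subset of \<open>S\<close>.\<close>
  define rep where "rep x = (SOME y. y \<in> S \<and> D x y = 0)" for x
  have rep: "rep x \<in> S" "D x (rep x) = 0" if "x \<in> S" for x
    using someI_ex[of "\<lambda>y. y \<in> S \<and> D x y = 0"] that D_refl unfolding rep_def by blast+
  have D_rep: "D (rep x) (rep y) = D x y" if "x \<in> S" "y \<in> S" for x y
    using D_triangle[of "rep x" x "rep y"] D_triangle[of x y "rep y"]
      D_triangle[of x "rep x" y] D_triangle[of "rep x" "rep y" y] rep that
      D_commute[of x "rep x"] D_commute[of y "rep y"] by auto
  have rep_eq: "rep x = rep y" if "x \<in> S" "y \<in> S" "D x y = 0" for x y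
  proof -
    have "D x z = 0 \<longleftrightarrow> D y z = 0" if z: "z \<in> S" for z
      using D_triangle[of x y z] D_triangle[of y x z] \<open>D x y = 0\<close> D_commute[of x y]
        D_nonneg[of x z] D_nonneg[of y z] z \<open>x \<in> S\<close> \<open>y \<in> S\<close> by auto
    then show ?thesis unfolding rep_def by metis
  qed
  define T where "T = rep ` S"
  have TS: "T \<subseteq> S" using rep by (auto simp: T_def)
  \<comment> \<open>Outside \<open>S\<close> the limit may be arbitrary, whereas a metric must be
    nonnegative on all arguments of the type; hence the absolute value.\<close>
  define d where "d x y = \<bar>D x y\<bar>" for x y
  have d: "d x y = D x y" if "x \<in> S" "y \<in> S" for x y using D_nonneg[OF that] by (simp add: d_def)
  interpret T: Metric_space T d
  proof
    show "0 \<le> d x y" "d x y = d y x" for x y by (simp_all add: d_def D_commute)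
  next
    fix x y assume "x \<in> T" "y \<in> T"
    then obtain u v where uv: "x = rep u" "y = rep v" "u \<in> S" "v \<in> S" by (auto simp: T_def)
    then have "d x y = D u v" using rep(1) by (simp add: d D_rep)
    moreover have "d x x = 0" using uv rep(1) by (simp add: d D_refl)
    ultimately show "d x y = 0 \<longleftrightarrow> x = y" using rep_eq[OF uv(3,4)] uv(1,2) by metis
  next
    fix x y z assume "x \<in> T" "y \<in> T" "z \<in> T"
    then have "x \<in> S" "y \<in> S" "z \<in> S" using TS by auto
    then show "d x z \<le> d x y + d y z" using D_triangle by (simp add: d)
  qed
  have "continuous_map (subtopology P S) T.mtopology rep"
    unfolding T.continuous_map_to_metric topS
  proof (intro ballI allI impI)
    fix x and e :: real assume x: "x \<in> S" and e: "0 < e"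
    have "\<forall>\<^sub>F k in sequentially. 4 * (1/2) ^ k < e / 2"
      using e by (intro order_tendstoD(2)[OF tendsto_geometric_half]) simp
    then obtain m where m: "4 * (1/2) ^ m < e / 2" by (auto simp: eventually_sequentially)
    \<comment> \<open>One coordinate controls the limit distance: the uniform error at
      \<open>m\<close> is below \<open>e / 2\<close>, and \<open>?U\<close> keeps the coordinate
      distance below \<open>e / 2\<close>.\<close>
    let ?U = "S \<inter> {y \<in> topspace P. mdist (X m) (x m) (y m) < e / 2}"
    have "openin (subtopology P S) ?U"
      using x SX by (intro openin_subtopology_Int2 open_near) (auto simp: topP)
    moreover have "x \<in> ?U"
    proof -
      have "mdist (X m) (x m) (x m) = 0" using SX[OF x] by simp
      then have "mdist (X m) (x m) (x m) < e / 2" using e by linarith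
      moreover have "x \<in> topspace P" using SX[OF x] by (simp add: topP)
      ultimately show ?thesis using x by blast
    qed
    moreover have "rep y \<in> T.mball (rep x) e" if y: "y \<in> ?U" for y
    proof -
      have "D x y < e" using D(2)[OF x, of y m] y m by auto
      moreover have "d (rep x) (rep y) = D x y" using x y by (simp add: d rep D_rep)
      moreover have "rep x \<in> T" "rep y \<in> T" using x y by (auto simp: T_def)
      ultimately show ?thesis by simp
    qed
    ultimately show "\<exists>U. openin (subtopology P S) U \<and> x \<in> U \<and> (\<forall>y\<in>U. rep y \<in> T.mball (rep x) e)"
      by blast
  qed
  then have "compactin T.mtopology (rep ` topspace (subtopology P S))"
    using compS unfolding compact_space_def by (rule image_compactin[rotated])
  then have compT: "compact_space T.mtopology"
    unfolding topS T_def[symmetric] by (simp add: compact_space_def)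
  have "S \<noteq> {}" using S_through[of _ 0] X[of 0] by (auto simp: compact_metric_def)
  then have "T \<noteq> {}" by (simp add: T_def)
  then have "compact_metric (metric (T, d))"
    using compT by (simp add: compact_metric_def T.mtopology_of)
  then obtain Y :: "real metric" where Y: "compact_metric Y" "isometric (metric (T, d)) Y"
    using compact_metric_isometric_real by blast
  obtain g where g: "isometric_embedding Y (metric (T, d)) g" "g ` mspace Y = T"
    using isometric_sym[OF Y(2)] unfolding isometric_def T.mspace_metric by blast
  have gT: "g y \<in> S" if "y \<in> mspace Y" for y using g(2) TS that by auto
  show thesis
  proof
    fix m
    \<comment> \<open>Evaluating threads at coordinate \<open>m\<close> has distortion at most
      \<open>4 * (1/2) ^ m\<close>. Its image is equally dense, since a thread runs through every
      point of \<open>X m\<close> and replacing it by its representative moves the coordinate by no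
      more than that error.\<close>
    have "gh_dist (X m) Y \<le> 3 * (4 * (1/2) ^ m)"
    proof (rule gh_dist_le_map[OF X Y(1)])
      show "(\<lambda>y. g y m) \<in> mspace Y \<rightarrow> mspace (X m)" using gT SX by auto
    next
      fix y y' assume y: "y \<in> mspace Y" "y' \<in> mspace Y"
      then have "mdist Y y y' = D (g y) (g y')"
        using g(1) gT by (auto simp: isometric_embedding_def d)
      then show "\<bar>mdist (X m) (g y m) (g y' m) - mdist Y y y'\<bar> \<le> 2 * (4 * (1/2) ^ m)"
        using D(2)[OF gT[OF y(1)] gT[OF y(2)], of m] by linarith
    next
      fix x assume "x \<in> mspace (X m)"
      then obtain s where s: "s \<in> S" "s m = x" using S_through by blast
      then have "rep s \<in> g ` mspace Y" unfolding g(2) T_def by blast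
      then obtain y where y: "y \<in> mspace Y" "g y = rep s" by auto
      have "mdist (X m) x (g y m) \<le> 4 * (1/2) ^ m"
        using D(2)[OF s(1) rep(1)[OF s(1)], of m] rep(2)[OF s(1)] s(2) y(2) by simp
      then show "\<exists>y\<in>mspace Y. mdist (X m) x (g y m) \<le> 4 * (1/2) ^ m" using y(1) by blast
    qed simp
    then show "gh_dist (X m) Y \<le> 12 * (1/2) ^ m" by simp
  qed (rule Y(1))
qed

instance gh_space :: complete_space
proof
  fix s :: "nat \<Rightarrow> gh_space" assume "Cauchy s"
  have "\<exists>r. \<forall>k. (\<forall>i\<ge>r k. \<forall>j\<ge>r k. dist (s i) (s j) < (1/2) ^ k) \<and> r k < r (Suc k)"
  proof (rule dependent_nat_choice)
    show "\<exists>N. \<forall>i\<ge>N. \<forall>j\<ge>N. dist (s i) (s j) < (1/2) ^ 0"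
      using \<open>Cauchy s\<close> unfolding Cauchy_def by simp
  next
    fix M k
    obtain N where "\<forall>i\<ge>N. \<forall>j\<ge>N. dist (s i) (s j) < (1/2) ^ Suc k"
      using \<open>Cauchy s\<close> unfolding Cauchy_def by (meson half_gt_zero_iff zero_less_one zero_less_power)
    then show "\<exists>N. (\<forall>i\<ge>N. \<forall>j\<ge>N. dist (s i) (s j) < (1/2) ^ Suc k) \<and> M < N"
      by (intro exI[of _ "max N (Suc M)"]) auto
  qed
  then obtain r where r: "\<And>k i j. r k \<le> i \<Longrightarrow> r k \<le> j \<Longrightarrow> dist (s i) (s j) < (1/2) ^ k"
    "\<And>k. r k < r (Suc k)" by blast
  have "gh_dist (rep_gh_space (s (r k))) (rep_gh_space (s (r (Suc k)))) < (1/2) ^ k" for k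
    using r(1)[of k "r k" "r (Suc k)"] r(2)[of k] by (simp add: dist_gh_space_def)
  then obtain Y where Y: "compact_metric Y"
    "\<And>k. gh_dist (rep_gh_space (s (r k))) Y \<le> 12 * (1/2) ^ k"
    using gh_fast_Cauchy_limit[of "\<lambda>k. rep_gh_space (s (r k))"] compact_metric_rep by blast
  have "dist (s (r k)) (isometry_class Y) \<le> 12 * (1/2) ^ k" for k
    using Y(2)[of k] dist_isometry_class[OF compact_metric_rep Y(1), of "s (r k)"]
      Quotient_abs_rep[OF Quotient_gh_space, of "s (r k)"] by simp
  then have "\<forall>\<^sub>F k in sequentially. norm (dist (s (r k)) (isometry_class Y)) \<le> 12 * (1/2) ^ k" by simp
  moreover have "(\<lambda>k. 12 * (1/2) ^ k :: real) \<longlonglongrightarrow> 0"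
    by (rule tendsto_geometric_half)
  ultimately have "(\<lambda>k. dist (s (r k)) (isometry_class Y)) \<longlonglongrightarrow> 0"
    by (rule Lim_null_comparison)
  then have "(s \<circ> r) \<longlonglongrightarrow> isometry_class Y"
    by (simp add: tendsto_dist_iff[of "s \<circ> r"])
  moreover have "strict_mono r" using r(2) by (simp add: strict_mono_Suc_iff)
  ultimately show "convergent s"
    using Cauchy_converges_subseq[OF \<open>Cauchy s\<close>] unfolding convergent_def by blast
qed

section \<open>Loose embeddings into the line\<close>

lemma suminf_quarter_tail:
  fixes t :: "nat \<Rightarrow> real"
  assumes t: "\<And>i. \<bar>t i\<bar> \<le> K" and zero: "\<And>i. i < N \<Longrightarrow> t i = 0"
  shows "summable (\<lambda>i. t i * (1/4) ^ i)"
    and "\<bar>\<Sum>i. t i * (1/4) ^ i\<bar> \<le> 4 / 3 * K * (1/4) ^ N"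
proof -
  have bound: "norm (t i * (1/4) ^ i) \<le> K * (1/4) ^ i" for i
    using t[of i] by (simp add: abs_mult mult_right_mono)
  have sumK: "summable (\<lambda>i. K * (1/4) ^ i :: real)"
    by (intro summable_mult summable_geometric) simp
  show sum: "summable (\<lambda>i. t i * (1/4) ^ i)"
    using bound by (rule summable_comparison_test'[OF sumK])
  have "(\<Sum>i. t i * (1/4) ^ i) = (\<Sum>i. t (i + N) * (1/4) ^ (i + N)) + (\<Sum>i<N. t i * (1/4) ^ i)"
    using sum by (rule suminf_split_initial_segment)
  also have "(\<Sum>i<N. t i * (1/4) ^ i) = 0" using zero by simp
  finally have "\<bar>\<Sum>i. t i * (1/4) ^ i\<bar> = norm (\<Sum>i. t (i + N) * (1/4) ^ (i + N))" by simp
  also have "\<dots> \<le> (\<Sum>i. K * (1/4) ^ N * (1/4) ^ i)"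
  proof (rule norm_suminf_le)
    show "summable (\<lambda>i. K * (1/4) ^ N * (1/4) ^ i :: real)"
      by (intro summable_mult summable_geometric) simp
    show "norm (t (i + N) * (1/4) ^ (i + N)) \<le> K * (1/4) ^ N * (1/4) ^ i" for i
      using bound[of "i + N"] by (simp add: power_add mult_ac)
  qed
  also have "\<dots> = K * (1/4) ^ N * (\<Sum>i. (1/4) ^ i)" by (rule suminf_mult) (simp add: summable_geometric)
  also have "(\<Sum>i. (1/4) ^ i) = (4 / 3 :: real)" by (simp add: suminf_geometric)
  finally show "\<bar>\<Sum>i. t i * (1/4) ^ i\<bar> \<le> 4 / 3 * K * (1/4) ^ N" by (simp add: mult_ac)
qed

text \<open>At the first nonzero digit \<open>n\<close> the tail is at most
  \<open>2/3 * (1/4) ^ n\<close>, too small to cancel a nonzero integer times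
  \<open>(1/4) ^ n\<close>. In base 3 the tail could equal \<open>(1/3) ^ n\<close>, which explains
  base 4.\<close>

lemma suminf_quarter_eq_0:
  fixes t :: "nat \<Rightarrow> int"
  assumes t: "\<And>i. \<bar>t i\<bar> \<le> 2" and 0: "(\<Sum>i. of_int (t i) * (1/4) ^ i :: real) = 0"
  shows "t i = 0"
proof (induction i rule: less_induct)
  case (less n)
  let ?u = "\<lambda>i. real_of_int (if i = n then 0 else t i)"
  have sum: "summable (\<lambda>i. real_of_int (t i) * (1/4) ^ i)"
    by (rule suminf_quarter_tail(1)[of _ 2 0]) (use t in \<open>simp_all flip: of_int_abs\<close>)
  have u: "\<bar>?u i\<bar> \<le> 2" "i < Suc n \<Longrightarrow> ?u i = 0" for i
    using t[of i] less.IH[of i] by (auto simp flip: of_int_abs)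
  have "(\<Sum>i. real_of_int (t i) * (1/4) ^ i) =
      (\<Sum>i. ?u i * (1/4) ^ i) + (\<Sum>i. if i = n then real_of_int (t n) * (1/4) ^ n else 0)"
    by (subst suminf_add[OF suminf_quarter_tail(1)[of ?u, OF u]]) (auto intro!: suminf_cong)
  also have "(\<Sum>i. if i = n then real_of_int (t n) * (1/4) ^ n else 0) = real_of_int (t n) * (1/4) ^ n"
    using suminf_finite[of "{n}" "\<lambda>i. if i = n then real_of_int (t n) * (1/4) ^ n else 0"] by simp
  finally have "real_of_int (t n) * (1/4) ^ n = - (\<Sum>i. ?u i * (1/4) ^ i)" using 0 by linarith
  then have "\<bar>real_of_int (t n) * (1/4) ^ n\<bar> = \<bar>\<Sum>i. ?u i * (1/4) ^ i\<bar>" by simp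
  then have "\<bar>real_of_int (t n)\<bar> * (1/4) ^ n = \<bar>\<Sum>i. ?u i * (1/4) ^ i\<bar>" by (simp add: abs_mult)
  also have "\<dots> \<le> 4 / 3 * 2 * (1/4) ^ Suc n" by (rule suminf_quarter_tail(2)[of ?u, OF u])
  also have "\<dots> < 1 * (1/4) ^ n" by simp
  finally have "\<bar>real_of_int (t n)\<bar> < 1" by (rule mult_right_less_imp_less) simp
  then show ?case by linarith
qed

text \<open>The hypothesis says that every label has the same multiplicity in the two unordered
  pairs; testing it at the four labels decides the matching.\<close>

lemma pair_eq_by_indicators:
  assumes "\<And>l. of_bool (a = l) + of_bool (b = l) - of_bool (c = l) - of_bool (d = l) = (0 :: int)"
  shows "a = c \<and> b = d \<or> a = d \<and> b = c"
  using assms[of a] assms[of b] assms[of c] assms[of d] by (auto simp: of_bool_def split: if_splits)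

text \<open>Write \<open>f x\<close> in base 4 with digit 1 at the positions coding the pairs \<open>(n, p n x)\<close> and
  digit 0 elsewhere, where \<open>p n\<close> is a locally constant labelling with fibres of diameter at most
  \<open>1 / (n + 1)\<close>.  Sums of two values have digits at most 2, hence no carries, so \<open>f x + f y\<close>
  determines the unordered pair of labels of \<open>x\<close> and \<open>y\<close> for every \<open>n\<close>.\<close>

lemma separated_imp_Sidon_map:
  assumes sep: "\<And>n. separated X (inverse (real (Suc n)))"
  shows "\<exists>f :: 'a \<Rightarrow> real.
    (\<forall>x\<in>mspace X. \<forall>e>0. \<exists>\<delta>>0. \<forall>y\<in>mspace X. mdist X x y < \<delta> \<longrightarrow> \<bar>f x - f y\<bar> < e) \<and>
    (\<forall>x\<in>mspace X. \<forall>y\<in>mspace X. \<forall>z\<in>mspace X. \<forall>w\<in>mspace X.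
       f x + f y = f z + f w \<longrightarrow> x = z \<and> y = w \<or> x = w \<and> y = z)"
proof -
  have "\<forall>n. \<exists>\<delta>>0. \<exists>p :: 'a \<Rightarrow> nat. \<forall>x\<in>mspace X. \<forall>y\<in>mspace X.
     (mdist X x y \<le> \<delta> \<longrightarrow> p x = p y) \<and> (p x = p y \<longrightarrow> mdist X x y \<le> inverse (real (Suc n)) - \<delta>)"
    using sep unfolding separated_def by blast
  then obtain \<delta> p where \<delta>: "\<And>n. 0 < \<delta> n" and
    near: "\<And>n x y. x \<in> mspace X \<Longrightarrow> y \<in> mspace X \<Longrightarrow> mdist X x y \<le> \<delta> n \<Longrightarrow> p n x = (p n y :: nat)" and
    small': "\<And>n x y. x \<in> mspace X \<Longrightarrow> y \<in> mspace X \<Longrightarrow> p n x = p n y \<Longrightarrow>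
      mdist X x y \<le> inverse (real (Suc n)) - \<delta> n"
    by metis
  have small: "mdist X x y \<le> inverse (real (Suc n))"
    if "x \<in> mspace X" "y \<in> mspace X" "p n x = p n y" for n x y
    using small'[OF that] \<delta>[of n] by linarith
  define digit :: "nat \<Rightarrow> 'a \<Rightarrow> int" where
    "digit i x = of_bool (p (fst (prod_decode i)) x = snd (prod_decode i))" for i x
  define f :: "'a \<Rightarrow> real" where "f x = (\<Sum>i. of_int (digit i x) * (1/4) ^ i)" for x
  have digit_bound: "\<bar>real_of_int (digit i x)\<bar> \<le> 1" for i x by (simp add: digit_def)
  have sum: "summable (\<lambda>i. of_int (digit i x) * (1/4) ^ i :: real)" for x
    by (rule suminf_quarter_tail(1)[of _ 1 0]) (simp_all add: digit_bound)
  show ?thesis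
  proof (intro exI[of _ f] conjI ballI allI impI)
    fix x and e :: real assume x: "x \<in> mspace X" and e: "0 < e"
    obtain N where N: "(1/4) ^ N < e * (3 / 4)"
      using real_arch_pow_inv[of "e * (3 / 4)" "1/4"] e by auto
    \<comment> \<open>A position below \<open>N\<close> codes a pair whose first component is below
      \<open>N\<close>, so agreement of the first \<open>N\<close> labellings fixes all digits
      before \<open>N\<close>. The 1 covers the case \<open>N = 0\<close>.\<close>
    define \<eta> where "\<eta> = Min (insert 1 (\<delta> ` {..<N}))"
    have "0 < \<eta>" using \<delta> by (simp add: \<eta>_def)
    moreover have "\<bar>f x - f y\<bar> < e" if y: "y \<in> mspace X" "mdist X x y < \<eta>" for y
    proof -
      let ?t = "\<lambda>i. real_of_int (digit i x - digit i y)"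
      have "?t i = 0" if "i < N" for i
      proof -
        have "fst (prod_decode i) \<le> i"
          using le_prod_encode_1[of "fst (prod_decode i)" "snd (prod_decode i)"] by simp
        then have "\<eta> \<le> \<delta> (fst (prod_decode i))" using that by (simp add: \<eta>_def)
        then have "p (fst (prod_decode i)) x = p (fst (prod_decode i)) y"
          using y by (intro near x) auto
        then show ?thesis by (simp add: digit_def)
      qed
      then have "\<bar>\<Sum>i. ?t i * (1/4) ^ i\<bar> \<le> 4 / 3 * 1 * (1/4) ^ N"
        by (intro suminf_quarter_tail(2)) (auto simp: digit_def)
      moreover have "f x - f y = (\<Sum>i. ?t i * (1/4) ^ i)"
        unfolding f_def suminf_diff[OF sum sum] by (simp add: left_diff_distrib)
      ultimately show ?thesis using N by simp
    qed
    ultimately show "\<exists>\<delta>>0. \<forall>y\<in>mspace X. mdist X x y < \<delta> \<longrightarrow> \<bar>f x - f y\<bar> < e" by blast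
  next
    fix x y z w assume in_X: "x \<in> mspace X" "y \<in> mspace X" "z \<in> mspace X" "w \<in> mspace X"
      and eq: "f x + f y = f z + f w"
    define t where "t i = digit i x + digit i y - digit i z - digit i w" for i
    have "(\<Sum>i. of_int (t i) * (1/4) ^ i) = f x + f y - f z - f w"
      unfolding f_def suminf_add[OF sum sum] suminf_diff[OF summable_add[OF sum sum] sum]
        suminf_diff[OF summable_diff[OF summable_add[OF sum sum] sum] sum]
      by (simp add: t_def algebra_simps)
    then have "(\<Sum>i. of_int (t i) * (1/4) ^ i :: real) = 0" using eq by simp
    moreover have "\<bar>t i\<bar> \<le> 2" for i by (simp add: t_def digit_def of_bool_def)
    ultimately have t0: "t i = 0" for i by (intro suminf_quarter_eq_0)
    have "p n x = p n z \<and> p n y = p n w \<or> p n x = p n w \<and> p n y = p n z" for n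
      by (rule pair_eq_by_indicators) (use t0[of "prod_encode (n, _)"] in \<open>simp add: t_def digit_def\<close>)
    then have cases: "(mdist X x z \<le> inverse (real (Suc n)) \<and> mdist X y w \<le> inverse (real (Suc n))) \<or>
        (mdist X x w \<le> inverse (real (Suc n)) \<and> mdist X y z \<le> inverse (real (Suc n)))" for n
      using small in_X by meson
    show "x = z \<and> y = w \<or> x = w \<and> y = z"
    proof (rule ccontr)
      assume no: "\<not> ?thesis"
      \<comment> \<open>Which of the two matchings holds may vary with \<open>n\<close>. If neither
        is exact, both maxima are positive, and a scale below \<open>m\<close> excludes both
        matchings at once.\<close>
      define m where "m = min (max (mdist X x z) (mdist X y w)) (max (mdist X x w) (mdist X y z))"
      have "0 < mdist X a b" if "a \<in> mspace X" "b \<in> mspace X" "a \<noteq> b" for a b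
        using that by (simp add: order_less_le)
      then have "0 < m" using no in_X unfolding m_def min_less_iff_conj less_max_iff_disj by metis
      then obtain n where "inverse (real (Suc n)) < m" using reals_Archimedean by blast
      then show False using cases[of n] unfolding m_def by linarith
    qed
  qed
qed

lemma distances_distinct_imp_loosely_embeddable:
  assumes sep: "\<And>n. separated X (inverse (real (Suc n)))" and dd: "distances_distinct X"
  shows "loosely_embeddable X"
proof -
  obtain f :: "'a \<Rightarrow> real" where
    cont: "\<forall>x\<in>mspace X. \<forall>e>0. \<exists>\<delta>>0. \<forall>y\<in>mspace X. mdist X x y < \<delta> \<longrightarrow> \<bar>f x - f y\<bar> < e" and
    Sidon: "\<forall>x\<in>mspace X. \<forall>y\<in>mspace X. \<forall>z\<in>mspace X. \<forall>w\<in>mspace X.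
       f x + f y = f z + f w \<longrightarrow> x = z \<and> y = w \<or> x = w \<and> y = z"
    using separated_imp_Sidon_map[OF sep] by (elim exE conjE)
  define g :: "'a \<Rightarrow> nat \<Rightarrow> real" where "g x i = (if i = 0 then f x else 0)" for x i
  let ?E = "Euclidean_space_metric 1"
  have gE: "g x \<in> mspace ?E" for x by (simp add: topspace_Euclidean_space g_def)
  have dg: "mdist ?E (g x) (g y) = \<bar>f x - f y\<bar>" for x y by (simp add: g_def)
  interpret X: Metric_space "mspace X" "mdist X" by simp
  interpret E: Metric_space "mspace ?E" "mdist ?E" by (rule Metric_space_mspace_mdist)
  have "continuous_map (mtopology_of X) (mtopology_of ?E) g"
    unfolding mtopology_of_def X.metric_continuous_map[OF E.Metric_space_axioms] dg
    using gE cont by blast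
  moreover have inj: "inj_on g (mspace X)"
  proof (rule inj_onI)
    fix x y assume "x \<in> mspace X" "y \<in> mspace X" "g x = g y"
    moreover then have "f x = f y" by (metis g_def)
    \<comment> \<open>Injectivity is the Sidon property for
      \<open>f x + f x = f y + f y\<close>.\<close>
    ultimately show "x = y" using Sidon by (metis (no_types))
  qed
  moreover have "\<bar>f x - f x'\<bar> = \<bar>f z - f z'\<bar> \<longleftrightarrow> mdist X x x' = mdist X z z'"
    if in_X: "x \<in> mspace X" "x' \<in> mspace X" "z \<in> mspace X" "z' \<in> mspace X" for x x' z z'
  proof
    assume "\<bar>f x - f x'\<bar> = \<bar>f z - f z'\<bar>"
    \<comment> \<open>Moving terms across turns equal differences into equal sums, where the Sidon
      property applies; its second alternative is the case in which both differences vanish.\<close>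
    then consider "f x + f z' = f z + f x'" | "f x + f z = f z' + f x'"
      by (auto simp: abs_eq_iff algebra_simps)
    then show "mdist X x x' = mdist X z z'"
    proof cases
      case 1
      then have "x = z \<and> z' = x' \<or> x = x' \<and> z' = z" using Sidon in_X by blast
      then show ?thesis using in_X by (metis mdist_zero)
    next
      case 2
      then have "x = z' \<and> z = x' \<or> x = x' \<and> z = z'" using Sidon in_X by blast
      then show ?thesis using in_X by (metis mdist_zero mdist_commute)
    qed
  next
    assume eq: "mdist X x x' = mdist X z z'"
    show "\<bar>f x - f x'\<bar> = \<bar>f z - f z'\<bar>"
    proof (cases "x = x'")
      case True
      then have "z = z'" using eq in_X by (metis mdist_zero)
      with True show ?thesis by simp
    next
      case False
      then have "{x, x'} = {z, z'}" using eq in_X dd unfolding distances_distinct_def by blast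
      then show ?thesis by (auto simp: doubleton_eq_iff)
    qed
  qed
  ultimately have "loose_embedding X ?E g" unfolding loose_embedding_def dg by blast
  then show ?thesis unfolding loosely_embeddable_def by blast
qed

section \<open>The zero-dimensional classes\<close>

lemma isometry_class_rep: "isometry_class (rep_gh_space p) = p"
  by (rule Quotient_abs_rep[OF Quotient_gh_space])

lemma zero_dim_classes_eq:
  "zero_dim_classes = (\<Inter>n. {p. separated (rep_gh_space p) (inverse (real (Suc n)))})"
proof (intro equalityI subsetI INT_I CollectI)
  fix p n assume "p \<in> zero_dim_classes"
  then obtain X where X: "compact_metric X" "has_covering_dim (mtopology_of X) 0" "p = isometry_class X"
    unfolding zero_dim_classes_def by blast
  show "separated (rep_gh_space p) (inverse (real (Suc n)))"
    unfolding X(3)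
    by (rule rep_gh_space_predicate[OF separated_perturb X(1)])
       (auto intro: zero_dim_imp_separated X(1,2))
next
  fix p assume "p \<in> (\<Inter>n. {p. separated (rep_gh_space p) (inverse (real (Suc n)))})"
  then have "has_covering_dim (mtopology_of (rep_gh_space p)) 0"
    by (intro separated_imp_zero_dim compact_metric_rep) blast
  then show "p \<in> zero_dim_classes"
    unfolding zero_dim_classes_def using compact_metric_rep isometry_class_rep[of p]
    by (metis (mono_tags, lifting) imageI mem_Collect_eq)
qed

lemma open_distances_distinct_at: "open {p. distances_distinct_at (rep_gh_space p) e}"
  by (intro open_class_predicate distances_distinct_at_perturb)

lemma distances_distinct_classes_loose:
  assumes "p \<in> zero_dim_classes"
    and "\<And>n. distances_distinct_at (rep_gh_space p) (inverse (real (Suc n)))"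
  shows "p \<in> loose_zero_dim_classes"
proof -
  have sep: "separated (rep_gh_space p) (inverse (real (Suc n)))" for n
    using assms(1) unfolding zero_dim_classes_eq by blast
  have "has_covering_dim (mtopology_of (rep_gh_space p)) 0"
    by (rule separated_imp_zero_dim[OF compact_metric_rep sep])
  moreover have "loosely_embeddable (rep_gh_space p)"
    by (intro distances_distinct_imp_loosely_embeddable[OF sep] distances_distinct_at_imp assms(2))
  ultimately show ?thesis
    unfolding loose_zero_dim_classes_def using compact_metric_rep isometry_class_rep[of p]
    by (metis (mono_tags, lifting) imageI mem_Collect_eq)
qed

text \<open>Finite spaces with distinct distances lie in both sets at once. Density of the
  intersection is the form required later, because nowhere density is measured inside
  \<open>zero_dim_classes\<close>.\<close>

lemma dense_zero_dim_distances_distinct: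
  assumes e: "0 < e"
  shows "closure (zero_dim_classes \<inter> {p. distances_distinct_at (rep_gh_space p) e}) = UNIV"
proof -
  have "\<exists>q\<in>zero_dim_classes \<inter> {p. distances_distinct_at (rep_gh_space p) e}. dist q p < r"
    if "0 < r" for p and r :: real
  proof -
    obtain Y where Y: "finite (mspace Y)" "compact_metric Y" "distances_distinct Y"
        "gh_dist (rep_gh_space p) Y < r"
      using compact_metric_approx_finite[OF compact_metric_rep \<open>0 < r\<close>] by metis
    have "separated (rep_gh_space (isometry_class Y)) (inverse (real (Suc n)))" for n
      by (rule rep_gh_space_predicate[OF separated_perturb Y(2)])
         (auto intro: finite_imp_separated Y(1))
    moreover have "distances_distinct_at (rep_gh_space (isometry_class Y)) e"
      by (rule rep_gh_space_predicate[OF distances_distinct_at_perturb Y(2)])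
         (auto intro: finite_imp_distances_distinct_at Y(1,3) e)
    moreover have "dist (isometry_class Y) p < r"
      using Y(4) dist_isometry_class[OF compact_metric_rep Y(2), of p]
      by (simp add: isometry_class_rep dist_commute)
    ultimately show ?thesis unfolding zero_dim_classes_eq by blast
  qed
  then show ?thesis by (auto simp: closure_approachable)
qed

section \<open>Baire category\<close>

lemma Baire_space_completely_metrizable:
  assumes "completely_metrizable_space X"
  shows "Baire_space X"
  unfolding Baire_space_def
proof (intro allI impI)
  fix \<U> assume \<U>: "countable \<U> \<and> (\<forall>U\<in>\<U>. openin X U \<and> X closure_of U = topspace X)"
  have "X closure_of \<Inter>\<U> = topspace X"
    by (rule Baire_category) (use assms \<U> in auto)
  then show "X closure_of (topspace X \<inter> \<Inter>\<U>) = topspace X"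
    by (simp flip: closure_of_restrict)
qed

theorem theorem0p3:
  shows "closure zero_dim_classes = (UNIV :: gh_space set) \<and>
         gdelta_in euclidean zero_dim_classes \<and>
         Baire_space (top_of_set zero_dim_classes) \<and>
         first_category_in (top_of_set zero_dim_classes)
           (zero_dim_classes - loose_zero_dim_classes)"
proof (intro conjI)
  let ?Z = zero_dim_classes
  let ?G = "\<lambda>n. {p. distances_distinct_at (rep_gh_space p) (inverse (real (Suc n)))}"
  have dense: "closure (?Z \<inter> ?G n) = UNIV" for n
    by (rule dense_zero_dim_distances_distinct) simp
  then show "closure ?Z = UNIV"
    using closure_mono[of "?Z \<inter> ?G 0" ?Z] by blast
  have "open {p. separated (rep_gh_space p) e}" for e
    by (intro open_class_predicate separated_perturb)
  then show gd: "gdelta_in euclidean ?Z"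
    unfolding zero_dim_classes_eq by (intro gdelta_in_Inter) (auto intro: open_imp_gdelta_in)
  show "Baire_space (top_of_set ?Z)"
    by (intro Baire_space_completely_metrizable completely_metrizable_space_gdelta_in gd
        completely_metrizable_space_euclidean)
  \<comment> \<open>Density of \<open>?Z \<inter> ?G n\<close> in the whole space restricts to
    density within \<open>?Z\<close>, so its relatively closed complement has empty interior
    there.\<close>
  have "closedin (top_of_set ?Z) (?Z - ?G n) \<and> (top_of_set ?Z) interior_of (?Z - ?G n) = {}" for n
  proof
    have "openin (top_of_set ?Z) (?Z \<inter> ?G n)"
      by (intro openin_open_Int open_distances_distinct_at)
    then have "closedin (top_of_set ?Z) (topspace (top_of_set ?Z) - ?Z \<inter> ?G n)"
      by (intro closedin_diff closedin_topspace)
    then show "closedin (top_of_set ?Z) (?Z - ?G n)" by (simp add: Diff_Int)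
    have "(top_of_set ?Z) closure_of ?G n = ?Z"
      using dense[of n] by (simp add: closure_of_subtopology)
    then show "(top_of_set ?Z) interior_of (?Z - ?G n) = {}"
      using interior_of_complement[of "top_of_set ?Z" "?G n"] by simp
  qed
  moreover have "?Z - loose_zero_dim_classes \<subseteq> (\<Union>n. ?Z - ?G n)"
    using distances_distinct_classes_loose by blast
  ultimately show "first_category_in (top_of_set ?Z) (?Z - loose_zero_dim_classes)"
    unfolding first_category_in_def by (intro exI[of _ "range (\<lambda>n. ?Z - ?G n)"]) blast
qed

end
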